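(* Let $R$ be a graded ring, $I$ a graded ideal of $R$, $J$ an arbitrary ideal of $R$ and $M$ a graded $R$-module. Then for every $i\ge 0$ there is a natural graded isomorphism $${}^{*}H^{i}_{I,J}(M)\;\cong\;\varinjlim_{\mathfrak c\in {}^{*}\widetilde W(I,J)} {}^{*}H^{i}_{\mathfrak c}(M).$$
   Context: Rings are commutative with identity; graded means $\mathbb Z$-graded. For ideals $I,J$ of $R$ and an $R$-module $M$, $\Gamma_{I,J}(M)=\{x\in M : I^{n}x\subseteq Jx \text{ for some integer } n\ge 1\}$ (equivalently, $I^n\subseteq \mathrm{ann}(x)+J$ for some $n\geq 1$). When $I$ and $M$ are graded, the paper regards $\Gamma_{I,J}(M)$ as a graded submodule of $M$ with components $\Gamma_{I,J}(M)_i=\Gamma_{I,J}(M)\cap M_i$, so that $\Gamma_{I,J}$ is an additive functor on the category of graded $R$-modules; ${}^{*}H^{i}_{I,J}$ denotes its $i$-th right derived functor on the category of graded $R$-modules. For a homogeneous ideal $\mathfrak c$, $\Gamma_{\mathfrak c}(M)=\{x\in M: \mathfrak c^n x=0 \text{ for some } n\geq 1\}$ and ${}^{*}H^{i}_{\mathfrak c}$ is the $i$-th right derived functor of $\Gamma_{\mathfrak c}$ on the category of graded $R$-modules. ${}^{*}\widetilde W(I,J)$ is the set of homogeneous ideals $\mathfrak c$ of $R$ such that $I^{n}\subseteq \mathfrak c+J$ for some integer $n$, partially ordered by $\mathfrak c\le\mathfrak d$ if $\mathfrak c\supseteq\mathfrak d$; for $\mathfrak c\le \mathfrak d$ there is the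 inclusion $\Gamma_{\mathfrak c}(M)\hookrightarrow\Gamma_{\mathfrak d}(M)$, and the transition maps of the direct system are those induced by these inclusions. *)

theory Defs
  imports "HOL-Algebra.Module" "HOL-Algebra.Ideal_Product"
begin

section \<open>Graded rings and graded modules\<close>

record 'a gr_ring = "'a ring" +
  rcomp :: "int \<Rightarrow> 'a set"

text \<open>As for \<^type>\<open>module\<close>, which extends \<^type>\<open>ring\<close>, the multiplicative fields of a
  module record carry no meaning.\<close>

record ('a, 'b) gr_module = "('a, 'b) module" +
  mcomp :: "int \<Rightarrow> 'b set"

definition is_decomposition ::
    "('a, 'b) ring_scheme \<Rightarrow> (int \<Rightarrow> 'a set) \<Rightarrow> 'a \<Rightarrow> (int \<Rightarrow> 'a) \<Rightarrow> bool" where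
  "is_decomposition A G x h \<longleftrightarrow>
     (\<forall>n. h n \<in> G n) \<and> finite {n. h n \<noteq> \<zero>\<^bsub>A\<^esub>} \<and> x = finsum A h {n. h n \<noteq> \<zero>\<^bsub>A\<^esub>}"

text \<open>The additive group of \<open>A\<close> is the internal direct sum of the subgroups \<open>G n\<close>.\<close>

definition is_grading :: "('a, 'b) ring_scheme \<Rightarrow> (int \<Rightarrow> 'a set) \<Rightarrow> bool" where
  "is_grading A G \<longleftrightarrow>
     (\<forall>n. additive_subgroup (G n) A) \<and> (\<forall>x\<in>carrier A. \<exists>!h. is_decomposition A G x h)"

locale graded_ring = cring R for R :: "('a, 'c) gr_ring_scheme" (structure) +
  assumes ring_grading: "is_grading R (rcomp R)"
    and rcomp_mult:
      "\<lbrakk>a \<in> rcomp R m; b \<in> rcomp R n\<rbrakk> \<Longrightarrow> a \<otimes> b \<in> rcomp R (m + n)"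

locale graded_module = R?: graded_ring R + M?: module R M
  for R :: "('a, 'c) gr_ring_scheme" (structure)
    and M :: "('a, 'b, 'd) gr_module_scheme" (structure) +
  assumes module_grading: "is_grading M (mcomp M)"
    and mcomp_smult:
      "\<lbrakk>a \<in> rcomp R m; x \<in> mcomp M n\<rbrakk> \<Longrightarrow> a \<odot>\<^bsub>M\<^esub> x \<in> mcomp M (m + n)"

definition homogeneous_ideal :: "('a, 'b) gr_ring_scheme \<Rightarrow> 'a set \<Rightarrow> bool" where
  "homogeneous_ideal R I \<longleftrightarrow>
     ideal I R \<and> (\<forall>x\<in>I. \<exists>h. is_decomposition R (\<lambda>n. I \<inter> rcomp R n) x h)"

text \<open>Morphisms of the category of graded modules: linear maps homogeneous of degree \<open>0\<close>. Only
  the values on the carrier of the source matter.\<close>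

definition gr_hom ::
    "('r, 'c) ring_scheme \<Rightarrow> ('r, 'a) gr_module \<Rightarrow> ('r, 'b) gr_module \<Rightarrow> ('a \<Rightarrow> 'b) \<Rightarrow> bool" where
  "gr_hom R A B f \<longleftrightarrow>
     f \<in> carrier A \<rightarrow> carrier B \<and>
     (\<forall>x\<in>carrier A. \<forall>y\<in>carrier A. f (x \<oplus>\<^bsub>A\<^esub> y) = f x \<oplus>\<^bsub>B\<^esub> f y) \<and>
     (\<forall>r\<in>carrier R. \<forall>x\<in>carrier A. f (r \<odot>\<^bsub>A\<^esub> x) = r \<odot>\<^bsub>B\<^esub> f x) \<and>
     (\<forall>n. f ` mcomp A n \<subseteq> mcomp B n)"

definition gr_iso ::
    "('r, 'c) ring_scheme \<Rightarrow> ('r, 'a) gr_module \<Rightarrow> ('r, 'b) gr_module \<Rightarrow> ('a \<Rightarrow> 'b) \<Rightarrow> bool" where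
  "gr_iso R A B f \<longleftrightarrow>
     gr_hom R A B f \<and> bij_betw f (carrier A) (carrier B) \<and> (\<forall>n. f ` mcomp A n = mcomp B n)"

section \<open>Right derived functors on the category of graded modules\<close>

subsection \<open>Injective resolutions\<close>

text \<open>Injectivity in the category of graded modules with elements in the type \<open>'e\<close> of the
  elements of \<open>E\<close>. As soon as \<open>'e\<close> is at least as large as \<open>'r\<close>, this category
  contains a copy of every shift of every homogeneous ideal of \<open>R\<close>, and by the graded version of
  Baer's criterion nothing changes if larger test modules are admitted.\<close>

definition gr_injective :: "('r, 'c) gr_ring_scheme \<Rightarrow> ('r, 'e) gr_module \<Rightarrow> bool" where
  "gr_injective R E \<longleftrightarrow>
     graded_module R E \<and>
     (\<forall>(A :: ('r, 'e) gr_module) (B :: ('r, 'e) gr_module) f g.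
        graded_module R A \<longrightarrow> graded_module R B \<longrightarrow>
        gr_hom R A B f \<longrightarrow> inj_on f (carrier A) \<longrightarrow> gr_hom R A E g \<longrightarrow>
        (\<exists>h. gr_hom R B E h \<and> (\<forall>x\<in>carrier A. h (f x) = g x)))"

record ('r, 'm, 'e) coresolution =
  res_aug :: "'m \<Rightarrow> 'e"
  res_obj :: "nat \<Rightarrow> ('r, 'e) gr_module"
  res_diff :: "nat \<Rightarrow> 'e \<Rightarrow> 'e"

definition injective_resolution ::
    "('r, 'c) gr_ring_scheme \<Rightarrow> ('r, 'm) gr_module \<Rightarrow> ('r, 'm, 'e) coresolution \<Rightarrow> bool" where
  "injective_resolution R M E \<longleftrightarrow>
     (\<forall>n. gr_injective R (res_obj E n)) \<and>
     gr_hom R M (res_obj E 0) (res_aug E) \<and>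
     (\<forall>n. gr_hom R (res_obj E n) (res_obj E (Suc n)) (res_diff E n)) \<and>
     inj_on (res_aug E) (carrier M) \<and>
     res_aug E ` carrier M = a_kernel (res_obj E 0) (res_obj E 1) (res_diff E 0) \<and>
     (\<forall>n. res_diff E n ` carrier (res_obj E n) =
          a_kernel (res_obj E (Suc n)) (res_obj E (Suc (Suc n))) (res_diff E (Suc n)))"

text \<open>Derived functors are formed, as usual, after fixing an injective resolution of every graded
  module. Such a choice exists for all modules with elements in \<open>'m\<close> once \<open>'e\<close> is large enough,
  for instance for \<open>'e = nat \<times> 'r \<Rightarrow> nat + 'm\<close>: the cardinality \<open>\<kappa>\<close> of that type satisfies
  \<open>\<kappa> = \<kappa>\<close> to the power \<open>max \<aleph>\<^sub>0 |R|\<close>, so every graded module of cardinality at most \<open>\<kappa>\<close>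
  embeds into an injective one of cardinality at most \<open>\<kappa>\<close> (the graded module of additive maps
  from \<open>R\<close> to a divisible hull).\<close>

definition injective_resolution_choice ::
    "('r, 'c) gr_ring_scheme \<Rightarrow> (('r, 'm) gr_module \<Rightarrow> ('r, 'm, 'e) coresolution) \<Rightarrow> bool" where
  "injective_resolution_choice R res \<longleftrightarrow>
     (\<forall>M. graded_module R M \<longrightarrow> injective_resolution R M (res M))"

definition is_lift ::
    "('r, 'c) gr_ring_scheme \<Rightarrow> ('r, 'm) gr_module \<Rightarrow> ('r, 'm, 'e) coresolution \<Rightarrow>
     ('r, 'm, 'e) coresolution \<Rightarrow> ('m \<Rightarrow> 'm) \<Rightarrow> (nat \<Rightarrow> 'e \<Rightarrow> 'e) \<Rightarrow> bool" where
  "is_lift R M E E' f g \<longleftrightarrow>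
     (\<forall>n. gr_hom R (res_obj E n) (res_obj E' n) (g n)) \<and>
     (\<forall>x\<in>carrier M. g 0 (res_aug E x) = res_aug E' (f x)) \<and>
     (\<forall>n. \<forall>x\<in>carrier (res_obj E n). g (Suc n) (res_diff E n x) = res_diff E' n (g n x))"

text \<open>Any two lifts are homotopic, so the choice does not affect the induced maps in cohomology.\<close>

definition some_lift ::
    "('r, 'c) gr_ring_scheme \<Rightarrow> ('r, 'm) gr_module \<Rightarrow> ('r, 'm, 'e) coresolution \<Rightarrow>
     ('r, 'm, 'e) coresolution \<Rightarrow> ('m \<Rightarrow> 'm) \<Rightarrow> nat \<Rightarrow> 'e \<Rightarrow> 'e" where
  "some_lift R M E E' f = (SOME g. is_lift R M E E' f g)"

subsection \<open>Cohomology of cochain complexes\<close>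

definition coboundaries ::
    "(nat \<Rightarrow> ('r, 'e) gr_module) \<Rightarrow> (nat \<Rightarrow> 'e \<Rightarrow> 'e) \<Rightarrow> nat \<Rightarrow> 'e set" where
  "coboundaries C d n =
     (case n of 0 \<Rightarrow> {\<zero>\<^bsub>C 0\<^esub>} | Suc k \<Rightarrow> d k ` carrier (C k))"

definition cohomology ::
    "(nat \<Rightarrow> ('r, 'e) gr_module) \<Rightarrow> (nat \<Rightarrow> 'e \<Rightarrow> 'e) \<Rightarrow> nat \<Rightarrow> ('r, 'e set) gr_module" where
  "cohomology C d n =
     (let Z = a_kernel (C n) (C (Suc n)) (d n); B = coboundaries C d n in
      \<lparr> carrier = {B +>\<^bsub>C n\<^esub> z | z. z \<in> Z},
        mult = undefined, one = undefined,
        zero = B,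
        add = set_add (C n),
        smult = (\<lambda>r X. B <+>\<^bsub>C n\<^esub> ((\<lambda>x. r \<odot>\<^bsub>C n\<^esub> x) ` X)),
        mcomp = (\<lambda>k. {B +>\<^bsub>C n\<^esub> z | z. z \<in> Z \<inter> mcomp (C n) k}) \<rparr>)"

text \<open>Map into the cohomology of \<open>(C', d')\<close> induced by a cochain map \<open>h\<close>.\<close>

definition cohomology_map ::
    "(nat \<Rightarrow> ('r, 'e) gr_module) \<Rightarrow> (nat \<Rightarrow> 'e \<Rightarrow> 'e) \<Rightarrow> (nat \<Rightarrow> 'e \<Rightarrow> 'e) \<Rightarrow>
     nat \<Rightarrow> 'e set \<Rightarrow> 'e set" where
  "cohomology_map C' d' h n X = coboundaries C' d' n <+>\<^bsub>C' n\<^esub> (h n ` X)"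

subsection \<open>Derived functors\<close>

record ('r, 'e) gr_functor =
  on_obj :: "('r, 'e) gr_module \<Rightarrow> ('r, 'e) gr_module"
  on_map :: "('r, 'e) gr_module \<Rightarrow> ('r, 'e) gr_module \<Rightarrow> ('e \<Rightarrow> 'e) \<Rightarrow> 'e \<Rightarrow> 'e"

definition apply_obj ::
    "('r, 'e) gr_functor \<Rightarrow> ('r, 'm, 'e) coresolution \<Rightarrow> nat \<Rightarrow> ('r, 'e) gr_module" where
  "apply_obj F E n = on_obj F (res_obj E n)"

definition apply_diff ::
    "('r, 'e) gr_functor \<Rightarrow> ('r, 'm, 'e) coresolution \<Rightarrow> nat \<Rightarrow> 'e \<Rightarrow> 'e" where
  "apply_diff F E n = on_map F (res_obj E n) (res_obj E (Suc n)) (res_diff E n)"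

definition right_derived ::
    "('r, 'e) gr_functor \<Rightarrow> (('r, 'm) gr_module \<Rightarrow> ('r, 'm, 'e) coresolution) \<Rightarrow> nat \<Rightarrow>
     ('r, 'm) gr_module \<Rightarrow> ('r, 'e set) gr_module" where
  "right_derived F res i M = cohomology (apply_obj F (res M)) (apply_diff F (res M)) i"

definition right_derived_map ::
    "('r, 'c) gr_ring_scheme \<Rightarrow> ('r, 'e) gr_functor \<Rightarrow>
     (('r, 'm) gr_module \<Rightarrow> ('r, 'm, 'e) coresolution) \<Rightarrow> nat \<Rightarrow>
     ('r, 'm) gr_module \<Rightarrow> ('r, 'm) gr_module \<Rightarrow> ('m \<Rightarrow> 'm) \<Rightarrow> 'e set \<Rightarrow> 'e set" where
  "right_derived_map R F res i M N f =
     cohomology_map (apply_obj F (res N)) (apply_diff F (res N))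
       (\<lambda>n. on_map F (res_obj (res M) n) (res_obj (res N) n)
              (some_lift R M (res M) (res N) f n)) i"

text \<open>Component at \<open>M\<close> of the transformation of right derived functors induced by a natural
  transformation \<open>\<tau>\<close> with target \<open>G\<close>.\<close>

definition right_derived_trans ::
    "('r, 'e) gr_functor \<Rightarrow> (('r, 'e) gr_module \<Rightarrow> 'e \<Rightarrow> 'e) \<Rightarrow>
     (('r, 'm) gr_module \<Rightarrow> ('r, 'm, 'e) coresolution) \<Rightarrow> nat \<Rightarrow>
     ('r, 'm) gr_module \<Rightarrow> 'e set \<Rightarrow> 'e set" where
  "right_derived_trans G \<tau> res i M =
     cohomology_map (apply_obj G (res M)) (apply_diff G (res M)) (\<lambda>n. \<tau> (res_obj (res M) n)) i"

section \<open>Direct limits of graded modules\<close>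

text \<open>The direct system consists of modules \<open>X c\<close>, \<open>c \<in> W\<close>, and maps
  \<open>t c d\<close> from \<open>X c\<close> to \<open>X d\<close> for \<open>leq c d\<close>, over a directed index set. Its limit is the quotient
  of the disjoint union by eventual equality.\<close>

definition eventually_equal ::
    "'i set \<Rightarrow> ('i \<Rightarrow> 'i \<Rightarrow> bool) \<Rightarrow> ('i \<Rightarrow> ('r, 'x) gr_module) \<Rightarrow> ('i \<Rightarrow> 'i \<Rightarrow> 'x \<Rightarrow> 'x) \<Rightarrow>
     (('i \<times> 'x) \<times> ('i \<times> 'x)) set" where
  "eventually_equal W leq X t =
     {((c, x), (d, y)) | c x d y.
        c \<in> W \<and> x \<in> carrier (X c) \<and> d \<in> W \<and> y \<in> carrier (X d) \<and>
        (\<exists>e\<in>W. leq c e \<and> leq d e \<and> t c e x = t d e y)}"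

definition direct_limit ::
    "'i set \<Rightarrow> ('i \<Rightarrow> 'i \<Rightarrow> bool) \<Rightarrow> ('i \<Rightarrow> ('r, 'x) gr_module) \<Rightarrow> ('i \<Rightarrow> 'i \<Rightarrow> 'x \<Rightarrow> 'x) \<Rightarrow>
     ('r, ('i \<times> 'x) set) gr_module" where
  "direct_limit W leq X t =
     (let E = eventually_equal W leq X t in
      \<lparr> carrier = (SIGMA c:W. carrier (X c)) // E,
        mult = undefined, one = undefined,
        zero = E `` {(c, \<zero>\<^bsub>X c\<^esub>) | c. c \<in> W},
        add = (\<lambda>P Q. E `` {(e, t c e x \<oplus>\<^bsub>X e\<^esub> t d e y) | c x d y e.
                 (c, x) \<in> P \<and> (d, y) \<in> Q \<and> e \<in> W \<and> leq c e \<and> leq d e}),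
        smult = (\<lambda>r P. E `` {(c, r \<odot>\<^bsub>X c\<^esub> x) | c x. (c, x) \<in> P}),
        mcomp = (\<lambda>k. {E `` {(c, x)} | c x. c \<in> W \<and> x \<in> mcomp (X c) k}) \<rparr>)"

text \<open>Map into the limit of the direct system \<open>(Y, s)\<close> induced by a morphism \<open>f\<close> of direct systems.\<close>

definition direct_limit_map ::
    "'i set \<Rightarrow> ('i \<Rightarrow> 'i \<Rightarrow> bool) \<Rightarrow> ('i \<Rightarrow> ('r, 'x) gr_module) \<Rightarrow> ('i \<Rightarrow> 'i \<Rightarrow> 'x \<Rightarrow> 'x) \<Rightarrow>
     ('i \<Rightarrow> 'x \<Rightarrow> 'x) \<Rightarrow> ('i \<times> 'x) set \<Rightarrow> ('i \<times> 'x) set" where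
  "direct_limit_map W leq Y s f P = eventually_equal W leq Y s `` {(c, f c x) | c x. (c, x) \<in> P}"

section \<open>Local cohomology with respect to a pair of ideals\<close>

definition ideal_power :: "('r, 'c) ring_scheme \<Rightarrow> 'r set \<Rightarrow> nat \<Rightarrow> 'r set" where
  "ideal_power R I n = I [^]\<^bsub>ideals_set R\<^esub> n"

definition gamma_pair_set ::
    "('r, 'c) ring_scheme \<Rightarrow> 'r set \<Rightarrow> 'r set \<Rightarrow> ('r, 'e) gr_module \<Rightarrow> 'e set" where
  "gamma_pair_set R I J M =
     {x \<in> carrier M. \<exists>n\<ge>1. (\<lambda>a. a \<odot>\<^bsub>M\<^esub> x) ` ideal_power R I n \<subseteq> (\<lambda>a. a \<odot>\<^bsub>M\<^esub> x) ` J}"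

definition gamma_set ::
    "('r, 'c) ring_scheme \<Rightarrow> 'r set \<Rightarrow> ('r, 'e) gr_module \<Rightarrow> 'e set" where
  "gamma_set R c M =
     {x \<in> carrier M. \<exists>n\<ge>1. \<forall>a\<in>ideal_power R c n. a \<odot>\<^bsub>M\<^esub> x = \<zero>\<^bsub>M\<^esub>}"

definition gr_submodule :: "('r, 'e) gr_module \<Rightarrow> 'e set \<Rightarrow> ('r, 'e) gr_module" where
  "gr_submodule M S = M\<lparr>carrier := S, mcomp := (\<lambda>n. S \<inter> mcomp M n)\<rparr>"

definition gamma_pair ::
    "('r, 'c) ring_scheme \<Rightarrow> 'r set \<Rightarrow> 'r set \<Rightarrow> ('r, 'e) gr_functor" where
  "gamma_pair R I J =
     \<lparr> on_obj = (\<lambda>A. gr_submodule A (gamma_pair_set R I J A)),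
       on_map = (\<lambda>A B f. restrict f (gamma_pair_set R I J A)) \<rparr>"

definition gamma :: "('r, 'c) ring_scheme \<Rightarrow> 'r set \<Rightarrow> ('r, 'e) gr_functor" where
  "gamma R c =
     \<lparr> on_obj = (\<lambda>A. gr_submodule A (gamma_set R c A)),
       on_map = (\<lambda>A B f. restrict f (gamma_set R c A)) \<rparr>"

definition W_tilde :: "('r, 'c) gr_ring_scheme \<Rightarrow> 'r set \<Rightarrow> 'r set \<Rightarrow> 'r set set" where
  "W_tilde R I J =
     {c. homogeneous_ideal R c \<and> (\<exists>n\<ge>1. ideal_power R I n \<subseteq> c <+>\<^bsub>R\<^esub> J)}"

definition W_le :: "'r set \<Rightarrow> 'r set \<Rightarrow> bool" where
  "W_le c d \<longleftrightarrow> d \<subseteq> c"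

text \<open>The transition map induced by the inclusion of \<open>\<Gamma>\<^sub>c\<close> in \<open>\<Gamma>\<^sub>d\<close>; its source plays no role
  in the formula.\<close>

definition local_cohomology_transition ::
    "('r, 'c) gr_ring_scheme \<Rightarrow> (('r, 'm) gr_module \<Rightarrow> ('r, 'm, 'e) coresolution) \<Rightarrow> nat \<Rightarrow>
     ('r, 'm) gr_module \<Rightarrow> 'r set \<Rightarrow> 'r set \<Rightarrow> 'e set \<Rightarrow> 'e set" where
  "local_cohomology_transition R res i M c d =
     right_derived_trans (gamma R d) (\<lambda>A x. x) res i M"

definition lim_local_cohomology ::
    "('r, 'c) gr_ring_scheme \<Rightarrow> 'r set \<Rightarrow> 'r set \<Rightarrow>
     (('r, 'm) gr_module \<Rightarrow> ('r, 'm, 'e) coresolution) \<Rightarrow> nat \<Rightarrow>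
     ('r, 'm) gr_module \<Rightarrow> ('r, ('r set \<times> 'e set) set) gr_module" where
  "lim_local_cohomology R I J res i M =
     direct_limit (W_tilde R I J) W_le
       (\<lambda>c. right_derived (gamma R c) res i M)
       (local_cohomology_transition R res i M)"

definition lim_local_cohomology_map ::
    "('r, 'c) gr_ring_scheme \<Rightarrow> 'r set \<Rightarrow> 'r set \<Rightarrow>
     (('r, 'm) gr_module \<Rightarrow> ('r, 'm, 'e) coresolution) \<Rightarrow> nat \<Rightarrow>
     ('r, 'm) gr_module \<Rightarrow> ('r, 'm) gr_module \<Rightarrow> ('m \<Rightarrow> 'm) \<Rightarrow>
     ('r set \<times> 'e set) set \<Rightarrow> ('r set \<times> 'e set) set" where
  "lim_local_cohomology_map R I J res i M N f =
     direct_limit_map (W_tilde R I J) W_le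
       (\<lambda>c. right_derived (gamma R c) res i N)
       (local_cohomology_transition R res i N)
       (\<lambda>c. right_derived_map R (gamma R c) res i M N f)"

end

theory Submission
  imports Defs
begin

text \<open>Let \<open>x\<close> be an element, not necessarily homogeneous, of a graded module, and let \<open>c\<close> be the
  ideal generated by the homogeneous components of all elements of \<open>ann(x)\<close>. By the Dedekind--Mertens
  argument, some power of \<open>c\<close> annihilates \<open>x\<close>, with an exponent that depends only on the number of
  components of \<open>x\<close>; hence \<open>c\<close> need not be finitely generated. If \<open>I\<^sup>n \<subseteq> ann(x) + J\<close>, then
  \<open>I\<^sup>n \<subseteq> c + J\<close>, and therefore \<open>\<Gamma>\<close> of the pair \<open>(I, J)\<close> is the union of the subfunctors \<open>\<Gamma>\<^sub>c\<close>
  over the system of ideals \<open>c\<close>, which is directed because it is closed under intersections.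
  Cohomology commutes with directed unions of subcomplexes of a fixed injective resolution.
  Naturality in the module uses only that a morphism lifts to the chosen resolutions.\<close>

section \<open>Homogeneous components\<close>

text \<open>The obstacle is that \<open>J\<close> is arbitrary. For an inhomogeneous
  \<open>x\<close> the obvious index \<open>ann(x)\<close> need not be homogeneous, and enlarging it
  by the components of its elements could destroy the property that it kills \<open>x\<close>.
  Reading \<open>a\<close> and \<open>x\<close> as Laurent polynomials in the degree turns
  \<open>a x = 0\<close> into the vanishing of all convolution sums, and a comparison of contents
  recovers a power that kills \<open>x\<close>. Each product of a fixed number of generators
  involves only finitely many annihilators, so a finite range of degrees can be assumed for the
  comparison. For the limit, every term is a subquotient \<open>Z c / B c\<close> of one and the
  same module of the resolution. The limit can therefore be computed on representatives, without an
  exactness theorem for direct limits.\<close>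

lemma finsum_additive:
  assumes "abelian_group A" "abelian_group B"
    and f: "\<And>x. x \<in> carrier A \<Longrightarrow> f x \<in> carrier B" "f \<zero>\<^bsub>A\<^esub> = \<zero>\<^bsub>B\<^esub>"
      "\<And>x y. \<lbrakk>x \<in> carrier A; y \<in> carrier A\<rbrakk> \<Longrightarrow> f (x \<oplus>\<^bsub>A\<^esub> y) = f x \<oplus>\<^bsub>B\<^esub> f y"
    and "finite F" "h \<in> F \<rightarrow> carrier A"
  shows "f (finsum A h F) = finsum B (\<lambda>i. f (h i)) F"
proof -
  interpret A: abelian_group A by fact
  interpret B: abelian_group B by fact
  show ?thesis using assms(6,7)
  proof (induction F rule: finite_induct)
    case empty then show ?case using f by simp
  next
    case (insert i F)
    then have "h \<in> F \<rightarrow> carrier A" "h i \<in> carrier A" by auto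
    then show ?case using insert f by (simp add: Pi_iff)
  qed
qed

lemma (in abelian_monoid) finsum_superset:
  assumes "finite F" "{n. h n \<noteq> \<zero>} \<subseteq> F" "h \<in> F \<rightarrow> carrier G"
  shows "finsum G h {n. h n \<noteq> \<zero>} = finsum G h F"
  using assms by (intro add.finprod_mono_neutral_cong_left) auto

text \<open>The description operator picks the whole family of components, whose uniqueness is part
  of \<open>is_grading\<close>; the value is meaningful only on the carrier.\<close>

definition component :: "('a, 'b) ring_scheme \<Rightarrow> (int \<Rightarrow> 'a set) \<Rightarrow> 'a \<Rightarrow> int \<Rightarrow> 'a" where
  "component A G x = (THE h. is_decomposition A G x h)"

text \<open>Only the additive group enters, so the same facts serve the ring and a module, whose
  record extends that of a ring.\<close>

locale graded_group = abelian_group A for A :: "('a, 'b) ring_scheme" (structure) +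
  fixes G :: "int \<Rightarrow> 'a set"
  assumes grading: "is_grading A G"
begin

lemma additive_subgroup_G: "additive_subgroup (G n) A"
  using grading unfolding is_grading_def by blast

lemma G_carr: "x \<in> G n \<Longrightarrow> x \<in> carrier A"
  using additive_subgroup.a_Hcarr[OF additive_subgroup_G] .

lemma G_zero [simp]: "\<zero> \<in> G n"
  using additive_subgroup.zero_closed[OF additive_subgroup_G] .

lemma G_add: "x \<in> G n \<Longrightarrow> y \<in> G n \<Longrightarrow> x \<oplus> y \<in> G n"
  using additive_subgroup.a_closed[OF additive_subgroup_G] .

abbreviation "hcomp \<equiv> component A G"

lemma decomposition_comp: "x \<in> carrier A \<Longrightarrow> is_decomposition A G x (hcomp x)"
  unfolding component_def using grading theI'[of "is_decomposition A G x"] by (simp add: is_grading_def)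

lemma comp_eqI: "\<lbrakk>x \<in> carrier A; is_decomposition A G x h\<rbrakk> \<Longrightarrow> hcomp x = h"
  using decomposition_comp grading unfolding is_grading_def by blast

text \<open>Any finite set containing the support is allowed: by cancellation, the support of a sum
  can be strictly smaller than the union of the supports.\<close>

lemma decompositionI:
  assumes "\<And>n. h n \<in> G n" "finite F" "\<And>n. n \<notin> F \<Longrightarrow> h n = \<zero>" "x = finsum A h F"
  shows "is_decomposition A G x h"
proof -
  have sub: "{n. h n \<noteq> \<zero>} \<subseteq> F" using assms by blast
  have "h \<in> F \<rightarrow> carrier A" using assms(1) G_carr by blast
  then show ?thesis
    unfolding is_decomposition_def using assms finsum_superset[OF assms(2) sub] finite_subset[OF sub]
    by simp
qed

lemma comp_in: "x \<in> carrier A \<Longrightarrow> hcomp x n \<in> G n"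
  using decomposition_comp unfolding is_decomposition_def by blast

lemma comp_closed [simp]: "x \<in> carrier A \<Longrightarrow> hcomp x n \<in> carrier A"
  using comp_in G_carr by blast

lemma finite_comp: "x \<in> carrier A \<Longrightarrow> finite {n. hcomp x n \<noteq> \<zero>}"
  using decomposition_comp unfolding is_decomposition_def by blast

lemma finsum_comp_support: "x \<in> carrier A \<Longrightarrow> finsum A (hcomp x) {n. hcomp x n \<noteq> \<zero>} = x"
  using decomposition_comp unfolding is_decomposition_def by metis

lemma finsum_comp:
  assumes "x \<in> carrier A" "finite F" "\<And>n. n \<notin> F \<Longrightarrow> hcomp x n = \<zero>"
  shows "finsum A (hcomp x) F = x"
  using finsum_superset[of F "hcomp x"] finsum_comp_support assms by fastforce

lemma comp_homogeneous:
  assumes "x \<in> G k"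
  shows "hcomp x n = (if n = k then x else \<zero>)"
proof -
  have "is_decomposition A G x (\<lambda>n. if n = k then x else \<zero>)"
    by (rule decompositionI[of _ "{k}"]) (use assms G_carr in auto)
  then show ?thesis using comp_eqI[OF G_carr[OF assms]] by simp
qed

lemma comp_zero [simp]: "hcomp \<zero> n = \<zero>"
  using comp_homogeneous[of \<zero> 0 n] by simp

lemma comp_add:
  assumes "x \<in> carrier A" "y \<in> carrier A"
  shows "hcomp (x \<oplus> y) n = hcomp x n \<oplus> hcomp y n"
proof -
  let ?F = "{n. hcomp x n \<noteq> \<zero>} \<union> {n. hcomp y n \<noteq> \<zero>}"
  have fin: "finite ?F" using finite_comp assms by blast
  have "is_decomposition A G (x \<oplus> y) (\<lambda>n. hcomp x n \<oplus> hcomp y n)"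
  proof (rule decompositionI[OF _ fin])
    show "x \<oplus> y = (\<Oplus>n\<in>?F. hcomp x n \<oplus> hcomp y n)"
      using assms finsum_comp[OF _ fin] by (subst finsum_addf) auto
  qed (use assms comp_in G_add in auto)
  then show ?thesis using comp_eqI[OF a_closed[OF assms]] by simp
qed

text \<open>Elements are finite sums of homogeneous ones. The empty sum falls under the homogeneous
  case since \<open>\<zero>\<close> has every degree.\<close>

lemma homogeneous_induct [consumes 1, case_names homogeneous add]:
  assumes "x \<in> carrier A"
    and homogeneous: "\<And>n x. x \<in> G n \<Longrightarrow> P x"
    and add: "\<And>x y. \<lbrakk>x \<in> carrier A; y \<in> carrier A; P x; P y\<rbrakk> \<Longrightarrow> P (x \<oplus> y)"
  shows "P x"
proof -
  have "P (finsum A (hcomp x) F)" if "finite F" for F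
    using that
  proof (induction F rule: finite_induct)
    case empty then show ?case using homogeneous[OF G_zero] by simp
  next
    case (insert n F)
    have F: "hcomp x \<in> F \<rightarrow> carrier A" using assms(1) by simp
    have "P (hcomp x n \<oplus> finsum A (hcomp x) F)"
      using comp_closed[OF assms(1)] finsum_closed[OF F] homogeneous[OF comp_in[OF assms(1)]]
        insert.IH by (rule add)
    then show ?case using insert.hyps F assms(1) by simp
  qed
  from this[OF finite_comp[OF assms(1)]] show ?thesis using finsum_comp_support[OF assms(1)] by simp
qed

lemma comp_finsum:
  assumes "finite F" "f \<in> F \<rightarrow> carrier A"
  shows "hcomp (finsum A f F) n = finsum A (\<lambda>i. hcomp (f i) n) F"
  using assms finsum_additive[of A A "\<lambda>x. hcomp x n" F f] comp_add abelian_group_axioms by simp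

end

context graded_module
begin

lemma graded_group_M: "graded_group M (mcomp M)"
  by (intro graded_group.intro M.abelian_group_axioms graded_group_axioms.intro module_grading)

lemma graded_group_R: "graded_group R (rcomp R)"
  by (intro graded_group.intro R.abelian_group_axioms graded_group_axioms.intro ring_grading)

sublocale M: graded_group M "mcomp M" by (rule graded_group_M)
sublocale R: graded_group R "rcomp R" by (rule graded_group_R)

lemma comp_smult_of_homogeneous:
  assumes "a \<in> carrier R" "x \<in> mcomp M m"
  shows "M.hcomp (a \<odot>\<^bsub>M\<^esub> x) n = R.hcomp a (n - m) \<odot>\<^bsub>M\<^esub> x"
  using assms(1)
proof (induction a rule: R.homogeneous_induct)
  case (homogeneous k a)
  then show ?case
    using R.comp_homogeneous[OF homogeneous] M.comp_homogeneous[OF mcomp_smult[OF homogeneous assms(2)]]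
      M.G_carr[OF assms(2)] by auto
next
  case (add a b)
  then show ?case
    using M.G_carr[OF assms(2)] by (simp add: smult_l_distr M.comp_add R.comp_add)
qed

text \<open>This is the product formula for Laurent polynomials. For \<open>a\<close> in the
  annihilator of \<open>x\<close> it yields, for each \<open>k\<close>, one relation between the
  components of \<open>a\<close> and those of \<open>x\<close>.\<close>

lemma comp_smult:
  assumes "a \<in> carrier R" "x \<in> carrier M" "finite J" "\<And>j. j \<notin> J \<Longrightarrow> M.hcomp x j = \<zero>\<^bsub>M\<^esub>"
  shows "M.hcomp (a \<odot>\<^bsub>M\<^esub> x) k = (\<Oplus>\<^bsub>M\<^esub>j\<in>J. R.hcomp a (k - j) \<odot>\<^bsub>M\<^esub> M.hcomp x j)"
proof -
  have "a \<odot>\<^bsub>M\<^esub> x = (\<Oplus>\<^bsub>M\<^esub>j\<in>J. a \<odot>\<^bsub>M\<^esub> M.hcomp x j)"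
    using finsum_smult_ldistr[of J a "M.hcomp x"] M.finsum_comp[of x J] assms by simp
  then show ?thesis
    using assms comp_smult_of_homogeneous[OF assms(1) M.comp_in[OF assms(2)]]
    by (simp add: M.comp_finsum)
qed

end

lemma (in graded_ring) graded_group: "graded_group R (rcomp R)"
  by (intro graded_group.intro abelian_group_axioms graded_group_axioms.intro ring_grading)

text \<open>Multiplication by a homogeneous scalar only shifts degrees. This serves to check that a
  set defined by conditions on components is closed under multiplication.\<close>

lemma (in graded_ring) comp_mult_homogeneous:
  assumes "r \<in> rcomp R m" "x \<in> carrier R"
  shows "component R (rcomp R) (r \<otimes> x) n = r \<otimes> component R (rcomp R) x (n - m)"
proof -
  interpret R: graded_group R "rcomp R" by (rule graded_group)
  show ?thesis using assms(2)
  proof (induction x rule: R.homogeneous_induct)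
    case (homogeneous k x)
    then show ?case
      using R.comp_homogeneous[OF homogeneous] R.comp_homogeneous[OF rcomp_mult[OF assms(1) homogeneous]]
        R.G_carr[OF assms(1)] by auto
  next
    case (add x y)
    then show ?case using R.G_carr[OF assms(1)] by (simp add: r_distr R.comp_add)
  qed
qed

section \<open>Lifting homomorphisms to injective resolutions\<close>

lemma gr_hom_closed: "\<lbrakk>gr_hom R A B f; x \<in> carrier A\<rbrakk> \<Longrightarrow> f x \<in> carrier B"
  and gr_hom_add: "\<lbrakk>gr_hom R A B f; x \<in> carrier A; y \<in> carrier A\<rbrakk> \<Longrightarrow> f (x \<oplus>\<^bsub>A\<^esub> y) = f x \<oplus>\<^bsub>B\<^esub> f y"
  and gr_hom_smult: "\<lbrakk>gr_hom R A B f; r \<in> carrier R; x \<in> carrier A\<rbrakk> \<Longrightarrow> f (r \<odot>\<^bsub>A\<^esub> x) = r \<odot>\<^bsub>B\<^esub> f x"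
  and gr_hom_mcomp: "\<lbrakk>gr_hom R A B f; x \<in> mcomp A n\<rbrakk> \<Longrightarrow> f x \<in> mcomp B n"
  unfolding gr_hom_def by blast+

lemma gr_hom_abelian_group_hom:
  assumes "module R A" "module R B" "gr_hom R A B f"
  shows "abelian_group_hom A B f"
proof -
  interpret A: module R A by fact
  interpret B: module R B by fact
  show ?thesis
    using gr_hom_closed[OF assms(3)] gr_hom_add[OF assms(3)] A.M.a_comm_group B.M.a_comm_group
    by (intro abelian_group_homI A.M.abelian_group_axioms B.M.abelian_group_axioms group_hom.intro
      group_hom_axioms.intro) (auto simp: hom_def comm_group_def)
qed

lemma gr_hom_comp: "\<lbrakk>gr_hom R A B f; gr_hom R B C g\<rbrakk> \<Longrightarrow> gr_hom R A C (\<lambda>x. g (f x))"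
  unfolding gr_hom_def by (auto simp: Pi_iff image_subset_iff)

text \<open>Both sides are additive in \<open>p\<close>, so homogeneous \<open>p\<close> suffice,
  and for those \<open>u\<close> keeps the degree.\<close>

lemma gr_hom_component:
  assumes "graded_module R P" "graded_module R M" "gr_hom R P M u" "p \<in> carrier P"
  shows "component M (mcomp M) (u p) n = u (component P (mcomp P) p n)"
proof -
  interpret P: graded_module R P by fact
  interpret M: graded_module R M by fact
  interpret u: abelian_group_hom P M u
    by (rule gr_hom_abelian_group_hom[OF P.module_axioms M.module_axioms assms(3)])
  show ?thesis using assms(4)
  proof (induction p rule: P.M.homogeneous_induct)
    case (homogeneous k x)
    then show ?case
      using P.M.comp_homogeneous[OF homogeneous] M.M.comp_homogeneous[OF gr_hom_mcomp[OF assms(3) homogeneous]]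
      by simp
  next
    case (add x y)
    then show ?case by (simp add: P.M.comp_add M.M.comp_add)
  qed
qed

lemma module_gr_submodule:
  assumes "module R M" "submodule H R M"
  shows "module R (gr_submodule M H)"
proof -
  have "module R (M\<lparr>carrier := H\<rparr>)"
    using submodule.submodule_is_module assms by blast
  then show ?thesis
    unfolding module_def abelian_group_def abelian_monoid_def abelian_group_axioms_def module_axioms_def
      gr_submodule_def by simp
qed

lemma submodule_image:
  assumes "module R P" "module R M" "gr_hom R P M u"
  shows "submodule (u ` carrier P) R M"
proof -
  interpret P: module R P by fact
  interpret M: module R M by fact
  interpret u: abelian_group_hom P M u using gr_hom_abelian_group_hom assms by blast
  show ?thesis
  proof (rule M.submoduleI)
    show "\<zero>\<^bsub>M\<^esub> \<in> u ` carrier P" using u.hom_zero P.M.zero_closed by (metis imageI)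
    show "\<ominus>\<^bsub>M\<^esub> a \<in> u ` carrier P" if "a \<in> u ` carrier P" for a
    proof -
      obtain p where p: "p \<in> carrier P" "a = u p" using \<open>a \<in> u ` carrier P\<close> by blast
      have "u (\<ominus>\<^bsub>P\<^esub> p) \<in> u ` carrier P" using p by (intro imageI) simp
      then show ?thesis using p by simp
    qed
    show "a \<oplus>\<^bsub>M\<^esub> b \<in> u ` carrier P" if ab: "a \<in> u ` carrier P" "b \<in> u ` carrier P" for a b
    proof -
      obtain p q where p: "p \<in> carrier P" "a = u p" "q \<in> carrier P" "b = u q" using ab by blast
      have "u (p \<oplus>\<^bsub>P\<^esub> q) \<in> u ` carrier P" using p by (intro imageI) simp
      then show ?thesis using p by simp
    qed
    show "r \<odot>\<^bsub>M\<^esub> x \<in> u ` carrier P" if r: "r \<in> carrier R" and x: "x \<in> u ` carrier P" for r x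
    proof -
      obtain p where p: "p \<in> carrier P" "x = u p" using x by blast
      have "u (r \<odot>\<^bsub>P\<^esub> p) \<in> u ` carrier P" using p r by (intro imageI) simp
      then show ?thesis using p r gr_hom_smult[OF assms(3)] by simp
    qed
  qed (use u.hom_closed in blast)
qed

text \<open>The components of \<open>u p\<close> are the images of the components of
  \<open>p\<close>, hence stay in the image. Being graded, the image can serve as a test module for
  injectivity.\<close>

lemma graded_module_image:
  assumes "graded_module R P" "graded_module R M" "gr_hom R P M u"
  shows "graded_module R (gr_submodule M (u ` carrier P))"
proof -
  interpret P: graded_module R P by fact
  interpret M: graded_module R M by fact
  let ?S = "u ` carrier P"
  let ?N = "gr_submodule M ?S"
  interpret u: abelian_group_hom P M u
    by (rule gr_hom_abelian_group_hom[OF P.module_axioms M.module_axioms assms(3)])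
  have S: "submodule ?S R M" using submodule_image assms(3) P.module_axioms M.module_axioms by blast
  interpret N: module R ?N using module_gr_submodule S M.module_axioms by blast
  have N_simps: "carrier ?N = ?S" "\<zero>\<^bsub>?N\<^esub> = \<zero>\<^bsub>M\<^esub>" "add ?N = add M" "smult ?N = smult M"
    "\<And>n. mcomp ?N n = ?S \<inter> mcomp M n"
    by (simp_all add: gr_submodule_def)
  have fin: "finsum ?N h F = finsum M h F" if "finite F" "h \<in> F \<rightarrow> ?S" for h and F :: "int set"
    using finsum_additive[of ?N M "\<lambda>x. x" F h, OF N.abelian_group_axioms M.M.abelian_group_axioms]
      that subsetD[OF M.submoduleE(1)[OF S]] by (simp only: N_simps refl simp_thms)
  \<comment> \<open>Decompositions in the image are those in \<open>M\<close> whose terms lie in the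
    image, so uniqueness is inherited from \<open>M\<close>.\<close>
  have dec: "is_decomposition ?N (mcomp ?N) x h \<longleftrightarrow>
      is_decomposition M (mcomp M) x h \<and> (\<forall>n. h n \<in> ?S)" for x h
  proof (cases "finite {n. h n \<noteq> \<zero>\<^bsub>M\<^esub>} \<and> (\<forall>n. h n \<in> ?S)")
    case True
    then have "finsum ?N h {n. h n \<noteq> \<zero>\<^bsub>M\<^esub>} = finsum M h {n. h n \<noteq> \<zero>\<^bsub>M\<^esub>}"
      by (intro fin) auto
    then show ?thesis unfolding is_decomposition_def N_simps by auto
  next
    case False
    then show ?thesis unfolding is_decomposition_def N_simps by auto
  qed
  have "is_grading ?N (mcomp ?N)"
    unfolding is_grading_def
  proof (intro conjI allI ballI)
    fix n
    show "additive_subgroup (mcomp ?N n) ?N"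
    proof (rule additive_subgroup.intro, rule group.subgroupI)
      show "Group.group (add_monoid ?N)" using N.a_comm_group comm_group.axioms(2) by blast
      have "\<zero>\<^bsub>M\<^esub> \<in> ?S" using M.submoduleE(1)[OF S] N.M.zero_closed N_simps by metis
      then show "mcomp ?N n \<noteq> {}" using M.M.G_zero N_simps by blast
      show "mcomp ?N n \<subseteq> carrier (add_monoid ?N)" by (simp add: N_simps)
      fix a assume a: "a \<in> mcomp ?N n"
      have "a \<in> ?S" using a by (simp add: N_simps)
      then have "\<ominus>\<^bsub>M\<^esub> a \<in> ?S" "a \<in> carrier M"
        using M.submoduleE(1,3)[OF S] by blast+
      then have "\<ominus>\<^bsub>?N\<^esub> a = \<ominus>\<^bsub>M\<^esub> a"
        using N.M.minus_equality[of "\<ominus>\<^bsub>M\<^esub> a" a] \<open>a \<in> ?S\<close> M.M.l_neg by (simp add: N_simps)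
      then have "inv\<^bsub>add_monoid ?N\<^esub> a = \<ominus>\<^bsub>M\<^esub> a" by (simp add: a_inv_def)
      then show "inv\<^bsub>add_monoid ?N\<^esub> a \<in> mcomp ?N n"
        using a M.submoduleE(3)[OF S] additive_subgroup.a_inv_closed[OF M.M.additive_subgroup_G]
        by (simp add: N_simps)
      fix b assume "b \<in> mcomp ?N n"
      then show "a \<otimes>\<^bsub>add_monoid ?N\<^esub> b \<in> mcomp ?N n"
        using a M.submoduleE(5)[OF S] M.M.G_add by (simp add: N_simps)
    qed
  next
    fix x assume x: "x \<in> carrier ?N"
    then obtain p where p: "p \<in> carrier P" "x = u p" by (auto simp: N_simps)
    have xM: "x \<in> carrier M" using p by simp
    have uS: "M.M.hcomp x n \<in> ?S" for n
      using p gr_hom_component[OF assms p(1)] by simp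
    then have "is_decomposition ?N (mcomp ?N) x (M.M.hcomp x)"
      using M.M.decomposition_comp[OF xM] dec by simp
    moreover have "h = M.M.hcomp x" if "is_decomposition ?N (mcomp ?N) x h" for h
      using that dec M.M.comp_eqI[OF xM, of h] by simp
    ultimately show "\<exists>!h. is_decomposition ?N (mcomp ?N) x h" by metis
  qed
  moreover have "a \<odot>\<^bsub>?N\<^esub> x \<in> mcomp ?N (m + n)" if "a \<in> rcomp R m" "x \<in> mcomp ?N n" for a x m n
    using that M.mcomp_smult M.submoduleE(4)[OF S] graded_group.G_carr[OF M.graded_group_R] by (simp add: N_simps)
  ultimately show ?thesis
    by (intro graded_module.intro graded_module_axioms.intro graded_module.axioms(1)[OF assms(2)] N.module_axioms)
qed

lemma gr_injective_graded_module: "gr_injective R E \<Longrightarrow> graded_module R E"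
  by (simp add: gr_injective_def)

text \<open>The test modules in the definition of injectivity have elements in \<open>'e\<close>, while \<open>P\<close> may live in
  another type; hence \<open>P\<close> is replaced by its image in \<open>B\<close>.\<close>

lemma gr_injective_extend:
  fixes B Q :: "('r, 'e) gr_module"
  assumes "gr_injective R Q" "graded_module R P" "graded_module R B"
    and u: "gr_hom R P B u" and v: "gr_hom R P Q v"
    and ker: "\<And>x. \<lbrakk>x \<in> carrier P; u x = \<zero>\<^bsub>B\<^esub>\<rbrakk> \<Longrightarrow> v x = \<zero>\<^bsub>Q\<^esub>"
  shows "\<exists>h. gr_hom R B Q h \<and> (\<forall>x\<in>carrier P. h (u x) = v x)"
proof -
  interpret P: graded_module R P by fact
  interpret B: graded_module R B by fact
  interpret Q: graded_module R Q using assms(1) by (rule gr_injective_graded_module)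
  interpret u: abelian_group_hom P B u
    by (rule gr_hom_abelian_group_hom[OF P.module_axioms B.module_axioms u])
  interpret v: abelian_group_hom P Q v
    by (rule gr_hom_abelian_group_hom[OF P.module_axioms Q.module_axioms v])
  let ?A = "gr_submodule B (u ` carrier P)"
  \<comment> \<open>\<open>g\<close> is to send \<open>u x\<close> to \<open>v x\<close>. Two
    preimages of the same element differ by an element of the kernel of \<open>u\<close>, which
    \<open>v\<close> kills as well, so the choice does not affect the value.\<close>
  define g where "g y = v (SOME x. x \<in> carrier P \<and> u x = y)" for y
  have g: "g (u x) = v x" if x: "x \<in> carrier P" for x
  proof -
    define x' where "x' = (SOME x'. x' \<in> carrier P \<and> u x' = u x)"
    have "\<exists>x'. x' \<in> carrier P \<and> u x' = u x" using x by blast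
    then have "x' \<in> carrier P \<and> u x' = u x" unfolding x'_def by (rule someI_ex)
    then have x': "x' \<in> carrier P" "u x' = u x" by auto
    have gx: "g (u x) = v x'" unfolding g_def x'_def ..
    let ?y = "x' \<oplus>\<^bsub>P\<^esub> \<ominus>\<^bsub>P\<^esub> x"
    have y: "?y \<in> carrier P" using P.M.a_closed[OF x'(1) P.M.a_inv_closed[OF x]] .
    have "u ?y = u x \<oplus>\<^bsub>B\<^esub> \<ominus>\<^bsub>B\<^esub> u x"
      using u.hom_add[OF x'(1) P.M.a_inv_closed[OF x]] u.hom_a_inv[OF x] x'(2) by (simp only:)
    then have "v ?y = \<zero>\<^bsub>Q\<^esub>" using ker[OF y] B.M.r_neg[OF u.hom_closed[OF x]] by (simp only:)
    then have "v x' \<oplus>\<^bsub>Q\<^esub> \<ominus>\<^bsub>Q\<^esub> v x = \<zero>\<^bsub>Q\<^esub>"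
      using v.hom_add[OF x'(1) P.M.a_inv_closed[OF x]] v.hom_a_inv[OF x] by (simp only:)
    then have "\<ominus>\<^bsub>Q\<^esub> (\<ominus>\<^bsub>Q\<^esub> v x) = v x'"
      using Q.M.minus_equality v.hom_closed x x'(1) Q.M.a_inv_closed by blast
    then show ?thesis using gx Q.M.minus_minus[OF v.hom_closed[OF x]] by (simp only:)
  qed
  have A: "graded_module R ?A" using graded_module_image assms(2,3) u by blast
  have incl: "gr_hom R ?A B (\<lambda>x. x)" "inj_on (\<lambda>x. x) (carrier ?A)"
    unfolding gr_hom_def gr_submodule_def by auto
  have gA: "gr_hom R ?A Q g"
    unfolding gr_hom_def
  proof (intro conjI ballI allI)
    show "g \<in> carrier ?A \<rightarrow> carrier Q" using g by (auto simp: gr_submodule_def)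
    show "g (x \<oplus>\<^bsub>?A\<^esub> y) = g x \<oplus>\<^bsub>Q\<^esub> g y" if xy: "x \<in> carrier ?A" "y \<in> carrier ?A" for x y
    proof -
      obtain p q where "p \<in> carrier P" "q \<in> carrier P" "x = u p" "y = u q"
        using xy by (auto simp: gr_submodule_def)
      then show ?thesis using g[of "p \<oplus>\<^bsub>P\<^esub> q"] g by (simp add: gr_submodule_def)
    qed
    show "g (r \<odot>\<^bsub>?A\<^esub> x) = r \<odot>\<^bsub>Q\<^esub> g x" if r: "r \<in> carrier R" and x: "x \<in> carrier ?A" for r x
    proof -
      obtain p where "p \<in> carrier P" "x = u p"
        using x by (auto simp: gr_submodule_def)
      then show ?thesis
        using r g[of "r \<odot>\<^bsub>P\<^esub> p"] g gr_hom_smult[OF u] gr_hom_smult[OF v]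
        by (simp add: gr_submodule_def)
    qed
    show "g ` mcomp ?A n \<subseteq> mcomp Q n" for n
    proof (intro image_subsetI)
      fix x assume "x \<in> mcomp ?A n"
      then obtain p where p: "p \<in> carrier P" "x = u p" and x: "x \<in> mcomp B n"
        by (auto simp: gr_submodule_def)
      \<comment> \<open>The preimage \<open>p\<close> may be inhomogeneous. Since \<open>x\<close>
        has degree \<open>n\<close>, the component of \<open>p\<close> in degree \<open>n\<close> is
        a preimage too.\<close>
      have "x = u (P.M.hcomp p n)"
        using B.M.comp_homogeneous[OF x, of n] gr_hom_component[OF assms(2,3) u p(1), of n] p(2) by simp
      then show "g x \<in> mcomp Q n"
        using g p P.M.comp_in gr_hom_mcomp[OF v] by simp
    qed
  qed
  obtain h where "gr_hom R B Q h" "\<forall>x\<in>carrier ?A. h x = g x"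
    using assms(1)[unfolded gr_injective_def, THEN conjunct2, rule_format, OF A assms(3) incl gA] by blast
  then show ?thesis using g by (auto simp: gr_submodule_def)
qed

section \<open>The comparison theorem for resolutions\<close>

lemma injective_resolutionD:
  assumes "injective_resolution R M E"
  shows "gr_injective R (res_obj E n)"
    and "gr_hom R M (res_obj E 0) (res_aug E)"
    and "gr_hom R (res_obj E n) (res_obj E (Suc n)) (res_diff E n)"
    and "inj_on (res_aug E) (carrier M)"
    and "res_aug E ` carrier M = a_kernel (res_obj E 0) (res_obj E (Suc 0)) (res_diff E 0)"
    and "res_diff E n ` carrier (res_obj E n) =
      a_kernel (res_obj E (Suc n)) (res_obj E (Suc (Suc n))) (res_diff E (Suc n))"
  using assms unfolding injective_resolution_def One_nat_def
  by simp_all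

lemma mem_a_kernel_iff: "x \<in> a_kernel A B f \<longleftrightarrow> x \<in> carrier A \<and> f x = \<zero>\<^bsub>B\<^esub>"
  by (simp add: a_kernel_def')

text \<open>The lift is built degree by degree. Extending the composite of \<open>g n\<close> and
  \<open>res_diff E' n\<close> along \<open>res_diff E n\<close> requires that it vanish on the
  cocycles of \<open>E\<close>. Exactness provides this: such cocycles come from the preceding
  stage, so \<open>g n\<close> takes them into an image in \<open>E'\<close>, which the next
  differential kills.\<close>

lemma injective_resolution_lift_exists:
  assumes "injective_resolution R M E" "injective_resolution R N E'"
    and "graded_module R M" "graded_module R N" "gr_hom R M N f"
  shows "\<exists>g. is_lift R M E E' f g"
proof -
  \<comment> \<open>The last conjunct is the invariant that makes the next extension possible; the
    augmentation is mentioned in degree 0 only.\<close>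
  let ?P = "\<lambda>n g. gr_hom R (res_obj E n) (res_obj E' n) g \<and>
      (n = 0 \<longrightarrow> (\<forall>x\<in>carrier M. g (res_aug E x) = res_aug E' (f x))) \<and>
      (\<forall>x\<in>carrier (res_obj E n). res_diff E n x = \<zero>\<^bsub>res_obj E (Suc n)\<^esub> \<longrightarrow>
        res_diff E' n (g x) = \<zero>\<^bsub>res_obj E' (Suc n)\<^esub>)"
  let ?Q = "\<lambda>n g g'. \<forall>x\<in>carrier (res_obj E n). g' (res_diff E n x) = res_diff E' n (g x)"
  note E = injective_resolutionD[OF assms(1)] and E' = injective_resolutionD[OF assms(2)]
  note obj = gr_injective_graded_module[OF E(1)] gr_injective_graded_module[OF E'(1)]
  have base: "\<exists>g. ?P 0 g"
  proof -
    interpret M: graded_module R M by fact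
    interpret E0: graded_module R "res_obj E 0" by (rule obj)
    interpret E'0: graded_module R "res_obj E' 0" by (rule obj)
    interpret a: abelian_group_hom M "res_obj E 0" "res_aug E"
      by (rule gr_hom_abelian_group_hom[OF M.module_axioms E0.module_axioms E(2)])
    have v: "gr_hom R M (res_obj E' 0) (\<lambda>x. res_aug E' (f x))"
      by (rule gr_hom_comp[OF assms(5) E'(2)])
    interpret v: abelian_group_hom M "res_obj E' 0" "\<lambda>x. res_aug E' (f x)"
      by (rule gr_hom_abelian_group_hom[OF M.module_axioms E'0.module_axioms v])
    have "res_aug E' (f x) = \<zero>\<^bsub>res_obj E' 0\<^esub>"
      if x: "x \<in> carrier M" "res_aug E x = \<zero>\<^bsub>res_obj E 0\<^esub>" for x
    proof -
      have "x = \<zero>\<^bsub>M\<^esub>" using inj_onD[OF E(4), of x "\<zero>\<^bsub>M\<^esub>"] x by simp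
      then show ?thesis using v.hom_zero by simp
    qed
    then obtain g where g: "gr_hom R (res_obj E 0) (res_obj E' 0) g"
        "\<forall>x\<in>carrier M. g (res_aug E x) = res_aug E' (f x)"
      using gr_injective_extend[OF E'(1) assms(3) obj(1) E(2) v] by blast
    moreover have "res_diff E' 0 (g x) = \<zero>\<^bsub>res_obj E' (Suc 0)\<^esub>"
      if x: "x \<in> carrier (res_obj E 0)" "res_diff E 0 x = \<zero>\<^bsub>res_obj E (Suc 0)\<^esub>" for x
    proof -
      have "x \<in> res_aug E ` carrier M" unfolding E(5) mem_a_kernel_iff using x by blast
      then obtain m where m: "m \<in> carrier M" "x = res_aug E m" by blast
      then have "g x \<in> res_aug E' ` carrier N" using g gr_hom_closed[OF assms(5)] by simp
      then show ?thesis unfolding E'(5) mem_a_kernel_iff by blast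
    qed
    ultimately show ?thesis by blast
  qed
  have step: "\<exists>g'. ?P (Suc n) g' \<and> ?Q n g g'" if P: "?P n g" for n g
  proof -
    have v: "gr_hom R (res_obj E n) (res_obj E' (Suc n)) (\<lambda>x. res_diff E' n (g x))"
      using P by (intro gr_hom_comp[OF _ E'(3)]) blast
    obtain g' where g': "gr_hom R (res_obj E (Suc n)) (res_obj E' (Suc n)) g'"
        "\<forall>x\<in>carrier (res_obj E n). g' (res_diff E n x) = res_diff E' n (g x)"
      using gr_injective_extend[OF E'(1) obj(1) obj(1) E(3) v] P by blast
    moreover have "res_diff E' (Suc n) (g' x) = \<zero>\<^bsub>res_obj E' (Suc (Suc n))\<^esub>"
      if x: "x \<in> carrier (res_obj E (Suc n))" "res_diff E (Suc n) x = \<zero>\<^bsub>res_obj E (Suc (Suc n))\<^esub>" for x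
    proof -
      have "x \<in> res_diff E n ` carrier (res_obj E n)" unfolding E(6) mem_a_kernel_iff using x by blast
      then obtain y where y: "y \<in> carrier (res_obj E n)" "x = res_diff E n y" by blast
      then have "g' x \<in> res_diff E' n ` carrier (res_obj E' n)" using g' gr_hom_closed[OF conjunct1[OF P] y(1)] by simp
      then show ?thesis unfolding E'(6) mem_a_kernel_iff by blast
    qed
    ultimately show ?thesis by blast
  qed
  have "\<exists>g. \<forall>n. ?P n (g n) \<and> ?Q n (g n) (g (Suc n))"
    by (rule dependent_nat_choice[of ?P ?Q, OF base step])
  then obtain g where g: "\<forall>n. ?P n (g n) \<and> ?Q n (g n) (g (Suc n))" ..
  have "is_lift R M E E' f g"
    unfolding is_lift_def
  proof (intro conjI allI)
    show "gr_hom R (res_obj E n) (res_obj E' n) (g n)" for n using spec[OF g, of n] by (elim conjE)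
    show "\<forall>x\<in>carrier M. g 0 (res_aug E x) = res_aug E' (f x)" using spec[OF g, of 0] by simp
    show "\<forall>x\<in>carrier (res_obj E n). g (Suc n) (res_diff E n x) = res_diff E' n (g n x)" for n
      using spec[OF g, of n] by (elim conjE)
  qed
  then show ?thesis by (intro exI[of _ g])
qed

section \<open>Annihilators of elements of graded modules\<close>

lemma submodule_additive_subgroup: "submodule H R M \<Longrightarrow> additive_subgroup H M"
  by (simp add: additive_subgroup_def submodule_def)

text \<open>For \<open>n > 0\<close> this is \<open>K : S^n\<close>, the elements that every product
  of \<open>n\<close> members of \<open>S\<close> takes into \<open>K\<close>, encoded without
  forming products; for \<open>n = 0\<close> it is \<open>K\<close>. Since \<open>S\<close> is any
  set of scalars, generators and whole ideals are treated alike.\<close>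

primrec colon :: "('a, 'b, 'd) module_scheme \<Rightarrow> 'a set \<Rightarrow> nat \<Rightarrow> 'b set \<Rightarrow> 'b set" where
  "colon M S 0 K = K"
| "colon M S (Suc n) K = {y \<in> carrier M. \<forall>s\<in>S. s \<odot>\<^bsub>M\<^esub> y \<in> colon M S n K}"

context module
begin

lemma submodule_zero: "submodule H R M \<Longrightarrow> \<zero>\<^bsub>M\<^esub> \<in> H"
  using additive_subgroup.zero_closed[OF submodule_additive_subgroup] .

lemma submodule_cancel:
  assumes "submodule H R M" "x \<in> H" "x \<oplus>\<^bsub>M\<^esub> y \<in> H" "y \<in> carrier M"
  shows "y \<in> H"
proof -
  have "x \<in> carrier M" using assms(1,2) submoduleE(1) by blast
  then have "\<ominus>\<^bsub>M\<^esub> x \<oplus>\<^bsub>M\<^esub> (x \<oplus>\<^bsub>M\<^esub> y) = y" using assms(4) by (rule M.r_neg1)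
  moreover have "\<ominus>\<^bsub>M\<^esub> x \<oplus>\<^bsub>M\<^esub> (x \<oplus>\<^bsub>M\<^esub> y) \<in> H"
    using submoduleE(5)[OF assms(1) submoduleE(3)[OF assms(1,2)] assms(3)] .
  ultimately show ?thesis by simp
qed

lemma submodule_finsum:
  assumes "submodule H R M" "finite F" "\<And>i. i \<in> F \<Longrightarrow> h i \<in> H"
  shows "finsum M h F \<in> H"
  using assms(2,3)
proof (induction F rule: finite_induct)
  case empty
  then show ?case using submodule_zero[OF assms(1)] by simp
next
  case (insert i F)
  have "h \<in> F \<rightarrow> carrier M" "h i \<in> carrier M"
    using insert.prems submoduleE(1)[OF assms(1)] by blast+
  moreover have "h i \<in> H" "finsum M h F \<in> H" using insert by simp_all
  ultimately show ?case using submoduleE(5)[OF assms(1)] insert.hyps by simp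
qed

lemma singleton_zero_submodule: "submodule {\<zero>\<^bsub>M\<^esub>} R M"
  by (rule submoduleI) auto

lemma colon_submodule:
  assumes "submodule K R M" "S \<subseteq> carrier R"
  shows "submodule (colon M S n K) R M"
proof (induction n)
  case 0
  then show ?case using assms by simp
next
  case (Suc n)
  let ?N = "colon M S n K"
  show ?case
  proof (rule submoduleI)
    show "\<zero>\<^bsub>M\<^esub> \<in> colon M S (Suc n) K"
      using assms(2) submodule_zero[OF Suc] by (auto simp: subset_iff)
    fix a assume a: "a \<in> colon M S (Suc n) K"
    show "\<ominus>\<^bsub>M\<^esub> a \<in> colon M S (Suc n) K"
      using a assms(2) submoduleE(3)[OF Suc] by (auto simp: smult_r_minus subset_iff)
    show "r \<odot>\<^bsub>M\<^esub> a \<in> colon M S (Suc n) K" if r: "r \<in> carrier R" for r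
    proof -
      have "s \<odot>\<^bsub>M\<^esub> (r \<odot>\<^bsub>M\<^esub> a) \<in> ?N" if s: "s \<in> S" for s
      proof -
        have sR: "s \<in> carrier R" using s assms(2) by blast
        have "s \<odot>\<^bsub>M\<^esub> (r \<odot>\<^bsub>M\<^esub> a) = r \<odot>\<^bsub>M\<^esub> (s \<odot>\<^bsub>M\<^esub> a)"
          using smult_assoc1[of s r a] smult_assoc1[of r s a] R.m_comm[OF sR r] r sR a by simp
        then show ?thesis using submoduleE(4)[OF Suc r, of "s \<odot>\<^bsub>M\<^esub> a"] s a by simp
      qed
      then show ?thesis using a r by simp
    qed
    fix b assume "b \<in> colon M S (Suc n) K"
    then show "a \<oplus>\<^bsub>M\<^esub> b \<in> colon M S (Suc n) K"
      using a assms(2) submoduleE(5)[OF Suc] by (auto simp: smult_r_distr subset_iff)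
  qed auto
qed

lemma colon_antimono: "S' \<subseteq> S \<Longrightarrow> colon M S n K \<subseteq> colon M S' n K"
  by (induction n) auto

lemma smult_left_commute:
  "\<lbrakk>r \<in> carrier R; s \<in> carrier R; x \<in> carrier M\<rbrakk> \<Longrightarrow> r \<odot>\<^bsub>M\<^esub> (s \<odot>\<^bsub>M\<^esub> x) = s \<odot>\<^bsub>M\<^esub> (r \<odot>\<^bsub>M\<^esub> x)"
  using smult_assoc1[of s r x] smult_assoc1[of r s x] R.m_comm[of r s] by simp

text \<open>Scalars commute, so a factor \<open>t\<close> may be applied last or first. This
  translates statements about the submodule \<open>K : t\<close> into statements about
  \<open>t y\<close>.\<close>

lemma mem_colon_colon_singleton:
  assumes "S \<subseteq> carrier R" "t \<in> carrier R" "y \<in> carrier M"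
  shows "y \<in> colon M S n (colon M {t} (Suc 0) K) \<longleftrightarrow> t \<odot>\<^bsub>M\<^esub> y \<in> colon M S n K"
  using assms(3)
proof (induction n arbitrary: y)
  case 0
  then show ?case by simp
next
  case (Suc n)
  have "s \<odot>\<^bsub>M\<^esub> y \<in> colon M S n (colon M {t} (Suc 0) K) \<longleftrightarrow> s \<odot>\<^bsub>M\<^esub> (t \<odot>\<^bsub>M\<^esub> y) \<in> colon M S n K"
    if "s \<in> S" for s
  proof -
    have s: "s \<in> carrier R" using that assms(1) by blast
    then show ?thesis
      using Suc.IH[of "s \<odot>\<^bsub>M\<^esub> y"] smult_left_commute[OF assms(2) s Suc.prems] Suc.prems by simp
  qed
  then show ?case using Suc.prems assms(2) by (simp del: colon.simps(2) add: colon.simps(2)[of M S])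
qed

text \<open>Among \<open>n + 1\<close> factors from \<open>S\<close>, either one lies in
  \<open>T\<close> and can be applied to \<open>y\<close> first, leaving \<open>n\<close> factors,
  or all lie in \<open>S'\<close>.\<close>

lemma colon_Un:
  assumes "S \<subseteq> carrier R" "S \<subseteq> S' \<union> T" "T \<subseteq> S" "S' \<subseteq> S"
    and "y \<in> colon M S' (Suc n) K" "\<And>t. t \<in> T \<Longrightarrow> t \<odot>\<^bsub>M\<^esub> y \<in> colon M S n K"
  shows "y \<in> colon M S (Suc n) K"
  using assms(5,6)
proof (induction n arbitrary: y)
  case 0
  then show ?case using assms(2) by auto
next
  case (Suc n)
  have y: "y \<in> carrier M" using Suc.prems(1) by simp
  have "s \<odot>\<^bsub>M\<^esub> y \<in> colon M S (Suc n) K" if s: "s \<in> S" for s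
  proof (cases "s \<in> T")
    case True
    then show ?thesis by (rule Suc.prems(2))
  next
    case False
    then have s': "s \<in> S'" using s assms(2) by blast
    show ?thesis
    proof (rule Suc.IH)
      show "s \<odot>\<^bsub>M\<^esub> y \<in> colon M S' (Suc n) K"
        using Suc.prems(1) s' by (simp only: colon.simps(2)[of M S' "Suc n"]) blast
      fix t assume t: "t \<in> T"
      have "s \<odot>\<^bsub>M\<^esub> (t \<odot>\<^bsub>M\<^esub> y) \<in> colon M S n K"
        using Suc.prems(2)[OF t] s by simp
      moreover have "s \<in> carrier R" "t \<in> carrier R" using s t assms by blast+
      ultimately show "t \<odot>\<^bsub>M\<^esub> (s \<odot>\<^bsub>M\<^esub> y) \<in> colon M S n K"
        using smult_left_commute[of t s y] y by simp
    qed
  qed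
  then show ?case using y by (subst colon.simps(2)) blast
qed

text \<open>Membership is tested on products of \<open>n\<close> factors, hence on finite subsets.
  Finiteness will confine all components involved to one bounded range of degrees.\<close>

lemma colon_finite_subsets:
  assumes "\<And>S0. \<lbrakk>finite S0; S0 \<subseteq> S\<rbrakk> \<Longrightarrow> y \<in> colon M S0 n K"
  shows "y \<in> colon M S n K"
  using assms
proof (induction n arbitrary: y)
  case 0
  from 0[of "{}"] show ?case by simp
next
  case (Suc n)
  have "s \<odot>\<^bsub>M\<^esub> y \<in> colon M S n K" if s: "s \<in> S" for s
  proof (rule Suc.IH)
    fix S0 assume S0: "finite S0" "S0 \<subseteq> S"
    have "y \<in> colon M (insert s S0) (Suc n) K" by (rule Suc.prems) (use S0 s in auto)
    then have "s \<odot>\<^bsub>M\<^esub> y \<in> colon M (insert s S0) n K" by simp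
    then show "s \<odot>\<^bsub>M\<^esub> y \<in> colon M S0 n K" using colon_antimono[of S0 "insert s S0"] by blast
  qed
  moreover have "y \<in> carrier M" using Suc.prems[of "{}"] by simp
  ultimately show ?case by simp
qed

lemma ideal_transporter:
  assumes "submodule N R M" "y \<in> carrier M"
  shows "ideal {r \<in> carrier R. r \<odot>\<^bsub>M\<^esub> y \<in> N} R"
proof (rule idealI)
  let ?T = "{r \<in> carrier R. r \<odot>\<^bsub>M\<^esub> y \<in> N}"
  show "ring R" by (rule R.ring_axioms)
  show left: "x \<otimes> a \<in> ?T" if "a \<in> ?T" "x \<in> carrier R" for a x
    using that assms submoduleE(4)[OF assms(1)] by (simp add: smult_assoc1)
  then show "a \<otimes> x \<in> ?T" if "a \<in> ?T" "x \<in> carrier R" for a x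
    using that R.m_comm[of a x] by (simp del: mem_Collect_eq) simp
  show "subgroup ?T (add_monoid R)"
  proof (rule R.add.subgroupI)
    show "?T \<noteq> {}" using submodule_zero[OF assms(1)] assms(2) R.zero_closed smult_l_null by force
    show "\<ominus> a \<in> ?T" if "a \<in> ?T" for a
      using that assms submoduleE(3)[OF assms(1)] by (simp add: smult_l_minus)
    show "a \<oplus> b \<in> ?T" if "a \<in> ?T" "b \<in> ?T" for a b
      using that assms submoduleE(5)[OF assms(1)] by (simp add: smult_l_distr)
  qed auto
qed

text \<open>The scalars that take a given element into a submodule form an ideal, so generators can
  be replaced by the ideal one factor at a time.\<close>

lemma colon_genideal:
  assumes "submodule K R M" "S \<subseteq> carrier R" "y \<in> colon M S n K"
  shows "y \<in> colon M (Idl S) n K"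
  using assms(3)
proof (induction n arbitrary: y)
  case 0
  then show ?case by simp
next
  case (Suc n)
  let ?N = "colon M (Idl S) n K"
  have y: "y \<in> carrier M" using Suc.prems by simp
  have "submodule ?N R M"
    using colon_submodule[OF assms(1)] ideal.Icarr[OF R.genideal_ideal[OF assms(2)]] by blast
  then have "ideal {r \<in> carrier R. r \<odot>\<^bsub>M\<^esub> y \<in> ?N} R" using y by (rule ideal_transporter)
  moreover have "S \<subseteq> {r \<in> carrier R. r \<odot>\<^bsub>M\<^esub> y \<in> ?N}" using Suc assms(2) by auto
  ultimately have "Idl S \<subseteq> {r \<in> carrier R. r \<odot>\<^bsub>M\<^esub> y \<in> ?N}" by (rule R.genideal_minimal)
  then show ?case using y by auto
qed

end

section \<open>The content formula\<close>

definition coeffs :: "(int \<Rightarrow> 'a) set \<Rightarrow> 'a set" where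
  "coeffs F = {f k | f k. f \<in> F}"

lemma coeffsI: "f \<in> F \<Longrightarrow> f k \<in> coeffs F"
  unfolding coeffs_def by blast

text \<open>The content formula \<open>c(f)\<^bsup>n+1\<^esup> c(g) \<subseteq> c(f)\<^bsup>n\<^esup> c(f g)\<close> for Laurent polynomials, stated for a whole
  family \<open>F\<close> of first factors so that mixed products of their coefficients are covered. Inner
  induction: remove the top coefficients \<open>T\<close> from the members of \<open>F\<close>; outer induction: remove the
  top term of \<open>g\<close>. The submodule \<open>K\<close> is arbitrary since the outer hypothesis is applied
  to \<open>K : t\<close> with \<open>t\<close> in \<open>T\<close>.\<close>

lemma (in module) dedekind_mertens:
  fixes g :: "int \<Rightarrow> 'c"
  assumes "finite J" "submodule K R M" "j \<in> J"
    and g: "\<And>j. j \<in> J \<Longrightarrow> g j \<in> carrier M"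
    and F: "coeffs F \<subseteq> carrier R" "\<And>f k. \<lbrakk>f \<in> F; k < lo \<or> lo + int p \<le> k\<rbrakk> \<Longrightarrow> f k = \<zero>"
    and conv: "\<And>f k. f \<in> F \<Longrightarrow> (\<Oplus>\<^bsub>M\<^esub>j\<in>J. f (k - j) \<odot>\<^bsub>M\<^esub> g j) \<in> colon M (coeffs F) (card J) K"
  shows "g j \<in> colon M (coeffs F) (Suc (card J)) K"
  using assms
\<comment> \<open>\<open>b\<close> is the largest index in \<open>J\<close>. The lower bound
  \<open>lo\<close> stays fixed because the members of \<open>F\<close> lose coefficients only at
  the top.\<close>
proof (induction J arbitrary: F K p j rule: finite_linorder_max_induct)
  case empty
  then show ?case by simp
next
  case (insert b A)
  let ?J = "insert b A"
  have b: "b \<notin> A" using insert.hyps(2) by blast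
  have card: "card ?J = Suc (card A)" using insert.hyps(1) b by simp
  from insert.prems show ?case
  proof (induction p arbitrary: F j)
    \<comment> \<open>The range of degrees is empty, so all coefficients vanish.\<close>
    case 0
    then have gj: "g j \<in> carrier M" by blast
    have "s \<odot>\<^bsub>M\<^esub> g j \<in> colon M (coeffs F) n K" if "s \<in> coeffs F" for s n
    proof -
      have "s = \<zero>" using that 0(5) unfolding coeffs_def by force
      then show ?thesis using gj submodule_zero[OF colon_submodule[OF 0(1,4)]] by simp
    qed
    then show ?case using gj by simp
  next
    case (Suc p)
    note K = Suc.prems(1) and g = Suc.prems(3) and SR = Suc.prems(4) and supp = Suc.prems(5)
    \<comment> \<open>The top of the \<open>p + 1\<close> degrees starting at
      \<open>lo\<close>.\<close>
    define m where "m = lo + int p"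
    let ?S = "coeffs F"
    define T where "T = {f m | f. f \<in> F}"
    define tr where "tr f = f(m := \<zero>)" for f :: "int \<Rightarrow> 'a"
    let ?S' = "coeffs (tr ` F)"
    have sub: "submodule (colon M ?S n K) R M" for n by (rule colon_submodule[OF K SR])
    have TS: "T \<subseteq> ?S" unfolding T_def coeffs_def by blast
    have S'S: "?S' \<subseteq> ?S"
    proof
      fix s assume "s \<in> ?S'"
      then obtain f k where f: "f \<in> F" "s = tr f k" unfolding coeffs_def by blast
      show "s \<in> ?S"
      proof (cases "k = m")
        case True
        \<comment> \<open>The truncated coefficient is \<open>\<zero>\<close>, which is also a
          coefficient of \<open>f\<close> itself, just above the range.\<close>
        then have "s = f (lo + int (Suc p))" using f supp[of f "lo + int (Suc p)"] by (simp add: tr_def)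
        then show ?thesis using f(1) by (simp add: coeffsI)
      next
        case False
        then show ?thesis using f by (simp add: tr_def coeffsI)
      qed
    qed
    have SST: "?S \<subseteq> ?S' \<union> T"
    proof
      fix s assume "s \<in> ?S"
      then obtain f k where f: "f \<in> F" "s = f k" unfolding coeffs_def by blast
      then have "k \<noteq> m \<Longrightarrow> s = tr f k" by (simp add: tr_def)
      then show "s \<in> ?S' \<union> T" using f coeffsI[of "tr f" "tr ` F" k] unfolding T_def by blast
    qed
    have fR: "f k \<in> carrier R" if "f \<in> F" for f k using SR coeffsI[OF that] by blast
    \<comment> \<open>A top coefficient saves one factor: the exponent is one less than in the
      goal.\<close>
    have tg: "t \<odot>\<^bsub>M\<^esub> g j \<in> colon M ?S (Suc (card A)) K" if t: "t \<in> T" and j: "j \<in> ?J" for t j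
    proof -
      obtain f0 where f0: "f0 \<in> F" "t = f0 m" using t unfolding T_def by blast
      have tR: "t \<in> carrier R" using fR f0 by simp
      \<comment> \<open>In total degree \<open>m + b\<close> only the product of the two top terms
        survives, as \<open>m + b - j\<close> exceeds \<open>m\<close> for
        \<open>j < b\<close>.\<close>
      have "f0 (m + b - j) \<odot>\<^bsub>M\<^esub> g j = \<zero>\<^bsub>M\<^esub>" if "j \<in> A" for j
      proof -
        have "j < b" using that insert.hyps(2) by blast
        then have "f0 (m + b - j) = \<zero>" using supp[OF f0(1)] by (simp add: m_def)
        then show ?thesis using g that by simp
      qed
      then have "(\<Oplus>\<^bsub>M\<^esub>j\<in>A. f0 (m + b - j) \<odot>\<^bsub>M\<^esub> g j) = \<zero>\<^bsub>M\<^esub>"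
        by (rule M.add.finprod_one_eqI)
      moreover have "(\<lambda>j. f0 (m + b - j) \<odot>\<^bsub>M\<^esub> g j) \<in> A \<rightarrow> carrier M"
        using fR[OF f0(1)] g by simp
      ultimately have "(\<Oplus>\<^bsub>M\<^esub>j\<in>?J. f0 (m + b - j) \<odot>\<^bsub>M\<^esub> g j) = t \<odot>\<^bsub>M\<^esub> g b"
        using insert.hyps(1) b g[of b] tR f0 by simp
      then have tgb: "t \<odot>\<^bsub>M\<^esub> g b \<in> colon M ?S (Suc (card A)) K"
        using Suc.prems(6)[OF f0(1), of "m + b"] card by simp
      show ?thesis
      proof (cases "j = b")
        case True
        then show ?thesis using tgb by simp
      next
        case False
        then have jA: "j \<in> A" using j by blast
        let ?K = "colon M {t} (Suc 0) K"
        \<comment> \<open>The outer hypothesis is applied to \<open>A\<close> and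
          \<open>K : t\<close>. Its premise is the convolution relation multiplied by
          \<open>t\<close>, which uses up one factor, minus the term with index \<open>b\<close>,
          which \<open>tgb\<close> controls.\<close>
        have "g j \<in> colon M ?S (Suc (card A)) ?K"
        proof (rule insert.IH[OF _ jA])
          show "submodule ?K R M" using colon_submodule[OF K] tR by blast
          show "g j \<in> carrier M" if "j \<in> A" for j using g that by blast
          show "?S \<subseteq> carrier R" by (rule SR)
          show "f k = \<zero>" if "f \<in> F" "k < lo \<or> lo + int (Suc p) \<le> k" for f k using that by (rule supp)
          fix f k assume f: "f \<in> F"
          let ?x = "f (k - b) \<odot>\<^bsub>M\<^esub> g b" and ?y = "\<Oplus>\<^bsub>M\<^esub>j\<in>A. f (k - j) \<odot>\<^bsub>M\<^esub> g j"
          have clos: "(\<lambda>j. f (k - j) \<odot>\<^bsub>M\<^esub> g j) \<in> A \<rightarrow> carrier M" using fR[OF f] g by simp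
          have y: "?y \<in> carrier M" and x: "?x \<in> carrier M"
            using M.finsum_closed[OF clos] fR[OF f] g by simp_all
          have "?x \<oplus>\<^bsub>M\<^esub> ?y \<in> colon M ?S (Suc (card A)) K"
            using Suc.prems(6)[OF f, of k] insert.hyps(1) b clos x card by simp
          then have "t \<odot>\<^bsub>M\<^esub> (?x \<oplus>\<^bsub>M\<^esub> ?y) \<in> colon M ?S (card A) K"
            using t TS by auto
          then have "t \<odot>\<^bsub>M\<^esub> ?x \<oplus>\<^bsub>M\<^esub> t \<odot>\<^bsub>M\<^esub> ?y \<in> colon M ?S (card A) K"
            using smult_r_distr[OF tR x y] by simp
          moreover have "t \<odot>\<^bsub>M\<^esub> ?x \<in> colon M ?S (card A) K"
          proof -
            have "f (k - b) \<odot>\<^bsub>M\<^esub> (t \<odot>\<^bsub>M\<^esub> g b) \<in> colon M ?S (card A) K"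
              using tgb coeffsI[OF f, of "k - b"] by simp
            then show ?thesis using smult_left_commute[OF tR fR[OF f]] g by simp
          qed
          ultimately have "t \<odot>\<^bsub>M\<^esub> ?y \<in> colon M ?S (card A) K"
            using submodule_cancel[OF sub] smult_closed[OF tR y] by blast
          then show "?y \<in> colon M ?S (card A) ?K"
            using mem_colon_colon_singleton[OF SR tR y] by blast
        qed
        then show ?thesis using mem_colon_colon_singleton[OF SR tR] g j by blast
      qed
    qed
    \<comment> \<open>The inner hypothesis is applied to the truncated family. Truncation affects at
      most one term of a convolution sum, the one with index \<open>k - m\<close>, and
      \<open>tg\<close> puts that term into the same submodule as the sum.\<close>
    have "g j \<in> colon M ?S' (Suc (card ?J)) K"
    proof (rule Suc.IH[OF K Suc.prems(2)])
      show "g j \<in> carrier M" if "j \<in> ?J" for j using g that by blast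
      show "?S' \<subseteq> carrier R" using S'S SR by blast
      show "f k = \<zero>" if f: "f \<in> tr ` F" and k: "k < lo \<or> lo + int p \<le> k" for f k
      proof -
        obtain f' where "f' \<in> F" "f = tr f'" using f by blast
        then show ?thesis using k supp[of f' k] by (cases "k = m") (auto simp: tr_def m_def)
      qed
      fix f' k assume "f' \<in> tr ` F"
      then obtain f where f: "f \<in> F" "f' = tr f" by blast
      let ?N = "colon M ?S (card ?J) K"
      have "(\<Oplus>\<^bsub>M\<^esub>j\<in>?J. f' (k - j) \<odot>\<^bsub>M\<^esub> g j) \<in> ?N"
      proof (cases "k - m \<in> ?J")
        case False
        then have "f' (k - j) = f (k - j)" if "j \<in> ?J" for j
          using that f(2) by (auto simp: tr_def)
        then have "(\<Oplus>\<^bsub>M\<^esub>j\<in>?J. f' (k - j) \<odot>\<^bsub>M\<^esub> g j) = (\<Oplus>\<^bsub>M\<^esub>j\<in>?J. f (k - j) \<odot>\<^bsub>M\<^esub> g j)"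
          using fR[OF f(1)] g by (intro M.finsum_cong') auto
        then show ?thesis using Suc.prems(6)[OF f(1)] by simp
      next
        case True
        let ?j = "k - m"
        define B where "B = ?J - {k - m}"
        have fin: "finite B" "?j \<notin> B" and J: "?J = insert ?j B"
          using insert.hyps(1) True by (auto simp: B_def)
        have gc: "g j \<in> carrier M" if "j \<in> insert ?j B" for j using that g J by blast
        have clos: "(\<lambda>j. f (k - j) \<odot>\<^bsub>M\<^esub> g j) \<in> B \<rightarrow> carrier M"
          using fR[OF f(1)] gc by blast
        have f'R: "f' (k - j) \<in> carrier R" for j using fR[OF f(1)] f(2) by (simp add: tr_def)
        have clos': "(\<lambda>j. f' (k - j) \<odot>\<^bsub>M\<^esub> g j) \<in> B \<rightarrow> carrier M"
          using f'R gc by blast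
        have eq: "(\<Oplus>\<^bsub>M\<^esub>j\<in>B. f' (k - j) \<odot>\<^bsub>M\<^esub> g j) = (\<Oplus>\<^bsub>M\<^esub>j\<in>B. f (k - j) \<odot>\<^bsub>M\<^esub> g j)"
          using clos f(2) by (intro M.finsum_cong') (auto simp: tr_def B_def)
        have 1: "(\<Oplus>\<^bsub>M\<^esub>j\<in>?J. f' (k - j) \<odot>\<^bsub>M\<^esub> g j) = (\<Oplus>\<^bsub>M\<^esub>j\<in>B. f (k - j) \<odot>\<^bsub>M\<^esub> g j)"
        proof -
          have "f' (k - ?j) \<odot>\<^bsub>M\<^esub> g ?j = \<zero>\<^bsub>M\<^esub>" using f(2) gc by (simp add: tr_def)
          then show ?thesis
            unfolding J using M.finsum_insert[OF fin clos'] M.finsum_closed[OF clos] eq by simp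
        qed
        have 2: "(\<Oplus>\<^bsub>M\<^esub>j\<in>?J. f (k - j) \<odot>\<^bsub>M\<^esub> g j) =
            f m \<odot>\<^bsub>M\<^esub> g ?j \<oplus>\<^bsub>M\<^esub> (\<Oplus>\<^bsub>M\<^esub>j\<in>B. f (k - j) \<odot>\<^bsub>M\<^esub> g j)"
          unfolding J using M.finsum_insert[OF fin clos] fR[OF f(1)] gc by simp
        have "f m \<odot>\<^bsub>M\<^esub> g ?j \<in> ?N"
          using tg[of "f m" ?j] True f(1) card unfolding T_def by auto
        then show ?thesis
          using submodule_cancel[OF sub _ _ M.finsum_closed[OF clos]] Suc.prems(6)[OF f(1), of k]
          unfolding 1 2 by blast
      qed
      then show "(\<Oplus>\<^bsub>M\<^esub>j\<in>?J. f' (k - j) \<odot>\<^bsub>M\<^esub> g j) \<in> colon M ?S' (card ?J) K"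
        using colon_antimono[OF S'S] by blast
    qed
    \<comment> \<open>A product of coefficients either has all factors in \<open>?S'\<close> or has
      a factor in \<open>T\<close>, and then \<open>tg\<close> applies.\<close>
    then show ?case
    proof (rule colon_Un[OF SR SST TS S'S])
      show "t \<odot>\<^bsub>M\<^esub> g j \<in> colon M ?S (card ?J) K" if "t \<in> T" for t
        using tg[OF that Suc.prems(2)] card by simp
    qed
  qed
qed

text \<open>The elements all of whose components lie in \<open>Idl S\<close> form an ideal
  \<open>?D\<close>. Homogeneous generators belong to it, hence so does all of
  \<open>Idl S\<close>.\<close>

lemma (in graded_ring) homogeneous_genideal:
  assumes "\<And>s. s \<in> S \<Longrightarrow> \<exists>n. s \<in> rcomp R n"
  shows "homogeneous_ideal R (Idl S)"
proof -
  interpret R: graded_group R "rcomp R" by (rule graded_group)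
  have S: "S \<subseteq> carrier R" using assms R.G_carr by blast
  interpret c: ideal "Idl S" R using S by (rule genideal_ideal)
  let ?D = "{x \<in> carrier R. \<forall>n. R.hcomp x n \<in> Idl S}"
  have mult: "r \<otimes> x \<in> ?D" if r: "r \<in> carrier R" and x: "x \<in> ?D" for r x
  proof -
    have "\<forall>n. R.hcomp (r \<otimes> x) n \<in> Idl S"
      using r
    proof (induction r rule: R.homogeneous_induct)
      case (homogeneous m r)
      then show ?case
        using comp_mult_homogeneous[OF homogeneous] x c.I_l_closed R.G_carr[OF homogeneous] by simp
    next
      case (add r s)
      then show ?case using x by (simp add: l_distr R.comp_add)
    qed
    then show ?thesis using r x by simp
  qed
  have "ideal ?D R"
  proof (rule idealI)
    show "ring R" by (rule ring_axioms)
    show "x \<otimes> a \<in> ?D" if "a \<in> ?D" "x \<in> carrier R" for a x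
      using mult[OF that(2,1)] .
    then show "a \<otimes> x \<in> ?D" if "a \<in> ?D" "x \<in> carrier R" for a x
      using that m_comm[of a x] by (simp del: mem_Collect_eq) simp
    show "subgroup ?D (add_monoid R)"
    proof (rule add.subgroupI)
      show "?D \<subseteq> carrier R" by blast
      show "?D \<noteq> {}" using c.zero_closed by force
      show "\<ominus> a \<in> ?D" if "a \<in> ?D" for a
        using mult[of "\<ominus> \<one>" a] that by (simp add: l_minus)
      show "a \<oplus> b \<in> ?D" if "a \<in> ?D" "b \<in> ?D" for a b
        using that by (simp add: R.comp_add)
    qed
  qed
  moreover have "S \<subseteq> ?D"
  proof
    fix s assume s: "s \<in> S"
    then obtain n where "s \<in> rcomp R n" using assms by blast
    then show "s \<in> ?D"
      using R.comp_homogeneous s S genideal_self[OF S] c.zero_closed by auto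
  qed
  ultimately have D: "Idl S \<subseteq> ?D" by (rule genideal_minimal)
  show ?thesis
    unfolding homogeneous_ideal_def
  proof (intro conjI ballI)
    show "ideal (Idl S) R" by (rule c.ideal_axioms)
    fix x assume x: "x \<in> Idl S"
    then have "x \<in> carrier R" by (rule c.Icarr)
    then have "is_decomposition R (\<lambda>n. Idl S \<inter> rcomp R n) x (R.hcomp x)"
      using R.decomposition_comp[of x] x D unfolding is_decomposition_def by auto
    then show "\<exists>h. is_decomposition R (\<lambda>n. Idl S \<inter> rcomp R n) x h" by blast
  qed
qed

section \<open>Powers of ideals, also modulo \<open>J\<close>\<close>

context cring
begin

lemma ideal_power_0 [simp]: "ideal_power R c 0 = carrier R"
  and ideal_power_Suc [simp]: "ideal_power R c (Suc n) = ideal_power R c n \<cdot>\<^bsub>R\<^esub> c"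
  by (simp_all add: ideal_power_def nat_pow_def ideals_set_def)

lemma ideal_ideal_power: "ideal c R \<Longrightarrow> ideal (ideal_power R c n) R"
  by (induction n) (simp_all add: oneideal ideal_prod_is_ideal)

lemma ideal_power_carr: "\<lbrakk>ideal c R; a \<in> ideal_power R c n\<rbrakk> \<Longrightarrow> a \<in> carrier R"
  using ideal_ideal_power ideal.Icarr by metis

lemma ideal_power_add:
  "ideal c R \<Longrightarrow> ideal_power R c (m + n) = ideal_power R c m \<cdot>\<^bsub>R\<^esub> ideal_power R c n"
  by (induction n) (simp_all add: ideal_prod_one ideal_ideal_power ideal_prod_assoc)

lemma ideal_power_mult:
  "ideal c R \<Longrightarrow> ideal_power R c (m * n) = ideal_power R (ideal_power R c m) n"
  by (induction n) (simp_all add: ideal_power_add ideal_prod_commute ideal_ideal_power)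

lemma ideal_power_antimono:
  assumes "ideal c R" "m \<le> n"
  shows "ideal_power R c n \<subseteq> ideal_power R c m"
proof -
  obtain k where "n = m + k" using assms(2) le_Suc_ex by blast
  then show ?thesis
    using ideal_prod_inter[OF ideal_ideal_power ideal_ideal_power, OF assms(1) assms(1)]
    by (simp add: ideal_power_add assms(1))
qed

lemma ideal_prod_mono: "\<lbrakk>A \<subseteq> A'; B \<subseteq> B'\<rbrakk> \<Longrightarrow> A \<cdot>\<^bsub>R\<^esub> B \<subseteq> A' \<cdot>\<^bsub>R\<^esub> B'"
proof
  fix x assume "A \<subseteq> A'" "B \<subseteq> B'" "x \<in> A \<cdot>\<^bsub>R\<^esub> B"
  from this(3,1,2) show "x \<in> A' \<cdot>\<^bsub>R\<^esub> B'"
    by (induction rule: ideal_prod.induct) (auto intro: ideal_prod.intros)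
qed

lemma ideal_power_mono: "c \<subseteq> d \<Longrightarrow> ideal_power R c n \<subseteq> ideal_power R d n"
  by (induction n) (simp_all add: ideal_prod_mono)

lemma mem_set_add_iff: "x \<in> A <+>\<^bsub>R\<^esub> B \<longleftrightarrow> (\<exists>a\<in>A. \<exists>b\<in>B. x = a \<oplus> b)"
  by (simp add: set_add_def')

text \<open>In the product of \<open>p + j\<close> and \<open>q + k\<close> every term other than
  \<open>p q\<close> has a factor in \<open>J\<close>.\<close>

lemma ideal_prod_add_subset:
  assumes "ideal a R" "ideal b R" "ideal J R" "A \<subseteq> a <+>\<^bsub>R\<^esub> J" "B \<subseteq> b <+>\<^bsub>R\<^esub> J"
  shows "A \<cdot>\<^bsub>R\<^esub> B \<subseteq> (a \<cdot>\<^bsub>R\<^esub> b) <+>\<^bsub>R\<^esub> J"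
proof
  interpret a: ideal a R by fact
  interpret b: ideal b R by fact
  interpret J: ideal J R by fact
  interpret s: ideal "(a \<cdot>\<^bsub>R\<^esub> b) <+>\<^bsub>R\<^esub> J" R
    by (intro add_ideals ideal_prod_is_ideal assms)
  fix x assume "x \<in> A \<cdot>\<^bsub>R\<^esub> B"
  then show "x \<in> (a \<cdot>\<^bsub>R\<^esub> b) <+>\<^bsub>R\<^esub> J"
  proof (induction rule: ideal_prod.induct)
    case (prod u v)
    obtain p j where u: "p \<in> a" "j \<in> J" "u = p \<oplus> j"
      using subsetD[OF assms(4) prod(1)] unfolding mem_set_add_iff by blast
    obtain q k where v: "q \<in> b" "k \<in> J" "v = q \<oplus> k"
      using subsetD[OF assms(5) prod(2)] unfolding mem_set_add_iff by blast
    have carr: "p \<in> carrier R" "j \<in> carrier R" "q \<in> carrier R" "k \<in> carrier R"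
      using u v a.Icarr b.Icarr J.Icarr by blast+
    have "u \<otimes> v = p \<otimes> q \<oplus> (j \<otimes> q \<oplus> (p \<otimes> k \<oplus> j \<otimes> k))"
      using carr u v by (simp add: l_distr r_distr a_assoc)
    moreover have "p \<otimes> q \<in> a \<cdot>\<^bsub>R\<^esub> b" using u v by (intro ideal_prod.prod)
    moreover have "j \<otimes> q \<oplus> (p \<otimes> k \<oplus> j \<otimes> k) \<in> J"
      using u v carr J.I_l_closed J.I_r_closed by simp
    ultimately show ?case unfolding mem_set_add_iff by blast
  next
    case (sum x y)
    then show ?case by (intro s.a_closed)
  qed
qed

lemma ideal_power_add_subset:
  assumes "ideal A R" "ideal c R" "ideal J R" "A \<subseteq> c <+>\<^bsub>R\<^esub> J"
  shows "ideal_power R A n \<subseteq> ideal_power R c n <+>\<^bsub>R\<^esub> J"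
proof (induction n)
  case 0
  have "x \<in> carrier R <+>\<^bsub>R\<^esub> J" if "x \<in> carrier R" for x
  proof -
    have "x = x \<oplus> \<zero>" using that by simp
    moreover have "\<zero> \<in> J" using assms(3) by (simp add: additive_subgroup.zero_closed ideal.axioms(1))
    ultimately show ?thesis unfolding mem_set_add_iff using that by blast
  qed
  then show ?case by auto
next
  case (Suc n)
  then show ?case
    using ideal_prod_add_subset[OF ideal_ideal_power assms(2,3)] assms by simp
qed

end

text \<open>This is the passage from iterated colons, which test single factors, to ideal powers,
  whose elements are sums of products.\<close>

lemma (in module) smult_ideal_power_colon:
  assumes "submodule K R M" "ideal c R" "a \<in> ideal_power R c n" "y \<in> colon M c n K"
  shows "a \<odot>\<^bsub>M\<^esub> y \<in> K"
  using assms(3,4)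
proof (induction n arbitrary: a y)
  case 0
  then show ?case using submoduleE(4)[OF assms(1)] by simp
next
  case (Suc n)
  have y: "y \<in> carrier M" using Suc.prems by simp
  from Suc.prems(1) have "a \<in> ideal_power R c n \<cdot>\<^bsub>R\<^esub> c" by simp
  \<comment> \<open>Membership in the ring is carried along because distributivity in the case of
    sums needs it for both summands.\<close>
  then have "a \<in> carrier R \<and> a \<odot>\<^bsub>M\<^esub> y \<in> K"
  proof (induction rule: ideal_prod.induct)
    case (prod u v)
    have "u \<in> carrier R" "v \<in> carrier R"
      using prod R.ideal_power_carr[OF assms(2)] ideal.Icarr[OF assms(2)] by blast+
    moreover have "u \<odot>\<^bsub>M\<^esub> (v \<odot>\<^bsub>M\<^esub> y) \<in> K"
      using Suc.IH[OF prod(1)] Suc.prems(2) prod(2) by simp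
    ultimately show ?case using y by (simp add: smult_assoc1)
  next
    case (sum u v)
    then show ?case using y submoduleE(5)[OF assms(1)] by (simp add: smult_l_distr)
  qed
  then show ?case by blast
qed

text \<open>The content formula is used with \<open>K = 0\<close>, for finitely many annihilators of
  \<open>x\<close> at a time; their convolution sums with the components of \<open>x\<close> vanish.
  The ideal is generated by all components of annihilators, and \<open>n\<close> is the number of
  nonzero components of \<open>x\<close>.\<close>

lemma (in graded_module) annihilator_subset_nilpotent_homogeneous_ideal:
  assumes x: "x \<in> carrier M"
  shows "\<exists>c n. homogeneous_ideal R c \<and> {a \<in> carrier R. a \<odot>\<^bsub>M\<^esub> x = \<zero>\<^bsub>M\<^esub>} \<subseteq> c \<and>
    (\<forall>a\<in>ideal_power R c (Suc n). a \<odot>\<^bsub>M\<^esub> x = \<zero>\<^bsub>M\<^esub>)"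
proof -
  let ?ann = "{a \<in> carrier R. a \<odot>\<^bsub>M\<^esub> x = \<zero>\<^bsub>M\<^esub>}"
  define S where "S = {R.hcomp a n | a n. a \<in> ?ann}"
  let ?J = "{j. M.hcomp x j \<noteq> \<zero>\<^bsub>M\<^esub>}"
  let ?q = "Suc (card ?J)"
  have finJ: "finite ?J" using M.finite_comp[OF x] .
  have SR: "S \<subseteq> carrier R" unfolding S_def using R.comp_closed by blast
  have "x \<in> colon M S ?q {\<zero>\<^bsub>M\<^esub>}"
  proof (rule colon_finite_subsets)
    fix S0 assume S0: "finite S0" "S0 \<subseteq> S"
    then have "\<forall>s\<in>S0. \<exists>a. a \<in> ?ann \<and> (\<exists>n. s = R.hcomp a n)" unfolding S_def by blast
    from bchoice[OF this]
    obtain w where w: "\<forall>s\<in>S0. w s \<in> ?ann \<and> (\<exists>n. s = R.hcomp (w s) n)" ..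
    \<comment> \<open>For each \<open>s\<close> the full component family of one annihilator is
      taken: the convolution relations hold for complete families, not for the coefficients in
      \<open>S0\<close> alone.\<close>
    define F where "F = (\<lambda>s. R.hcomp (w s)) ` S0"
    define U where "U = (\<Union>s\<in>S0. {n. R.hcomp (w s) n \<noteq> \<zero>})"
    have finU: "finite U" unfolding U_def using S0(1) w R.finite_comp by blast
    \<comment> \<open>Inserting \<open>0\<close> ensures that minimum and maximum are meaningful
      when \<open>U\<close> is empty.\<close>
    define lo hi where "lo = Min (insert 0 U)" and "hi = Max (insert 0 U)"
    have U: "U \<subseteq> {lo..hi}" using finU by (auto simp: lo_def hi_def)
    have F: "coeffs F \<subseteq> carrier R" unfolding coeffs_def F_def using w R.comp_closed by auto
    have sub: "submodule (colon M (coeffs F) ?q {\<zero>\<^bsub>M\<^esub>}) R M"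
      by (rule colon_submodule[OF singleton_zero_submodule F])
    have "M.hcomp x j \<in> colon M (coeffs F) ?q {\<zero>\<^bsub>M\<^esub>}" if "j \<in> ?J" for j
    proof (rule dedekind_mertens[OF finJ singleton_zero_submodule that _ F, where lo = lo and p = "nat (hi - lo + 1)"])
      show "M.hcomp x j \<in> carrier M" for j using x by simp
      show "f k = \<zero>" if "f \<in> F" "k < lo \<or> lo + int (nat (hi - lo + 1)) \<le> k" for f k
      proof -
        have "k \<notin> U" using that(2) U by fastforce
        then show ?thesis using that(1) unfolding F_def U_def by blast
      qed
      show "(\<Oplus>\<^bsub>M\<^esub>j\<in>?J. f (k - j) \<odot>\<^bsub>M\<^esub> M.hcomp x j) \<in> colon M (coeffs F) (card ?J) {\<zero>\<^bsub>M\<^esub>}"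
        if f: "f \<in> F" for f k
      proof -
        obtain s where s: "s \<in> S0" "f = R.hcomp (w s)" using f unfolding F_def by blast
        have "M.hcomp (w s \<odot>\<^bsub>M\<^esub> x) k = (\<Oplus>\<^bsub>M\<^esub>j\<in>?J. f (k - j) \<odot>\<^bsub>M\<^esub> M.hcomp x j)"
          unfolding s(2) using comp_smult[OF _ x finJ, of "w s" k] w s(1) by simp
        moreover have "M.hcomp (w s \<odot>\<^bsub>M\<^esub> x) k = \<zero>\<^bsub>M\<^esub>" using w s(1) by simp
        ultimately show ?thesis
          using submodule_zero[OF colon_submodule[OF singleton_zero_submodule F]] by simp
      qed
    qed
    then have "finsum M (M.hcomp x) ?J \<in> colon M (coeffs F) ?q {\<zero>\<^bsub>M\<^esub>}"
      by (rule submodule_finsum[OF sub finJ])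
    then have "x \<in> colon M (coeffs F) ?q {\<zero>\<^bsub>M\<^esub>}" using M.finsum_comp_support[OF x] by (simp only:)
    moreover have "S0 \<subseteq> coeffs F" using w unfolding coeffs_def F_def by blast
    ultimately show "x \<in> colon M S0 ?q {\<zero>\<^bsub>M\<^esub>}" using colon_antimono by blast
  qed
  then have "x \<in> colon M (Idl S) ?q {\<zero>\<^bsub>M\<^esub>}"
    by (rule colon_genideal[OF singleton_zero_submodule SR])
  then have "\<forall>a\<in>ideal_power R (Idl S) ?q. a \<odot>\<^bsub>M\<^esub> x = \<zero>\<^bsub>M\<^esub>"
    using smult_ideal_power_colon[OF singleton_zero_submodule R.genideal_ideal[OF SR]] by blast
  moreover have "homogeneous_ideal R (Idl S)"
    using R.comp_in by (intro homogeneous_genideal) (auto simp: S_def)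
  moreover have "?ann \<subseteq> Idl S"
  proof
    fix a assume a: "a \<in> ?ann"
    interpret c: ideal "Idl S" R using SR by (rule R.genideal_ideal)
    have comp: "R.hcomp a n \<in> Idl S" for n using a R.genideal_self[OF SR] unfolding S_def by blast
    have "finsum R (R.hcomp a) Q \<in> Idl S" if "finite Q" for Q
      using that
    proof (induction Q rule: finite_induct)
      case (insert n Q)
      then show ?case using a R.comp_closed comp by (simp add: Pi_def)
    qed simp
    then have "finsum R (R.hcomp a) {n. R.hcomp a n \<noteq> \<zero>} \<in> Idl S" using R.finite_comp[of a] a by simp
    then show "a \<in> Idl S" using R.finsum_comp_support[of a] a by simp
  qed
  ultimately show ?thesis by blast
qed

section \<open>Torsion with respect to a pair of ideals\<close>

lemma homogeneous_ideal_ideal: "homogeneous_ideal R I \<Longrightarrow> ideal I R"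
  by (simp add: homogeneous_ideal_def)

lemma W_tilde_ideal: "c \<in> W_tilde R I J \<Longrightarrow> ideal c R"
  by (simp add: W_tilde_def homogeneous_ideal_def)

text \<open>Decompositions in \<open>R\<close> are unique, so the one inside \<open>c\<close> and
  the one inside \<open>d\<close> coincide.\<close>

lemma (in graded_ring) homogeneous_ideal_Int:
  assumes "homogeneous_ideal R c" "homogeneous_ideal R d"
  shows "homogeneous_ideal R (c \<inter> d)"
proof -
  interpret R: graded_group R "rcomp R" by (rule graded_group)
  have dec: "is_decomposition R (\<lambda>n. e \<inter> rcomp R n) x h \<longleftrightarrow> is_decomposition R (rcomp R) x h \<and> (\<forall>n. h n \<in> e)"
    for e x h by (auto simp: is_decomposition_def)
  have in_e: "R.hcomp x n \<in> e" if e: "homogeneous_ideal R e" "x \<in> e" for e x n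
  proof -
    have x: "x \<in> carrier R" using ideal.Icarr[OF homogeneous_ideal_ideal[OF e(1)] e(2)] .
    obtain h where "is_decomposition R (rcomp R) x h" "\<forall>n. h n \<in> e"
      using e(1)[unfolded homogeneous_ideal_def dec] e(2) by blast
    then show ?thesis using R.comp_eqI[OF x] by simp
  qed
  have cd: "ideal (c \<inter> d) R"
    by (intro i_intersect homogeneous_ideal_ideal assms)
  moreover have "\<exists>h. is_decomposition R (\<lambda>n. (c \<inter> d) \<inter> rcomp R n) x h" if x: "x \<in> c \<inter> d" for x
  proof
    have "R.hcomp x n \<in> c \<inter> d" for n using x in_e[OF assms(1)] in_e[OF assms(2)] by blast
    then show "is_decomposition R (\<lambda>n. (c \<inter> d) \<inter> rcomp R n) x (R.hcomp x)"
      using R.decomposition_comp[OF ideal.Icarr[OF cd x]] dec[of "c \<inter> d"] by simp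
  qed
  ultimately show ?thesis unfolding homogeneous_ideal_def by blast
qed

text \<open>\<open>W_le\<close> reverses inclusion, so intersections are the upper bounds that make
  the system directed. Multiplying the two containments gives \<open>I^(m+n)\<close> inside
  \<open>c d + J\<close>, and \<open>c d\<close> lies in the intersection.\<close>

lemma (in graded_ring) W_tilde_Int:
  assumes I: "ideal I R" and J: "ideal J R" and c: "c \<in> W_tilde R I J" and d: "d \<in> W_tilde R I J"
  shows "c \<inter> d \<in> W_tilde R I J"
proof -
  obtain m n where mn: "m \<ge> 1" "ideal_power R I m \<subseteq> c <+>\<^bsub>R\<^esub> J" "ideal_power R I n \<subseteq> d <+>\<^bsub>R\<^esub> J"
    using c d unfolding W_tilde_def by blast
  have ci: "ideal c R" and di: "ideal d R" using c d W_tilde_ideal by blast+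
  have "ideal_power R I (m + n) \<subseteq> (c \<cdot>\<^bsub>R\<^esub> d) <+>\<^bsub>R\<^esub> J"
    unfolding ideal_power_add[OF I] by (rule ideal_prod_add_subset[OF ci di J mn(2,3)])
  also have "\<dots> \<subseteq> (c \<inter> d) <+>\<^bsub>R\<^esub> J"
    unfolding set_add_def' using ideal_prod_inter[OF ci di] by blast
  finally have "ideal_power R I (m + n) \<subseteq> (c \<inter> d) <+>\<^bsub>R\<^esub> J" .
  moreover have "m + n \<ge> 1" using mn(1) by simp
  moreover have "homogeneous_ideal R (c \<inter> d)"
    using c d by (intro homogeneous_ideal_Int) (simp_all add: W_tilde_def)
  ultimately show ?thesis unfolding W_tilde_def by blast
qed

lemma (in graded_ring) self_mem_W_tilde:
  assumes "homogeneous_ideal R I" "ideal J R"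
  shows "I \<in> W_tilde R I J"
proof -
  have I: "ideal I R" using assms(1) by (rule homogeneous_ideal_ideal)
  have "ideal_power R I 1 \<subseteq> I"
    using ideal_prod_inter[OF oneideal I] by simp
  also have "I \<subseteq> I <+>\<^bsub>R\<^esub> J"
  proof
    fix x assume "x \<in> I"
    moreover have "x = x \<oplus> \<zero>" using calculation ideal.Icarr[OF I] by simp
    moreover have "\<zero> \<in> J" using assms(2) by (simp add: additive_subgroup.zero_closed ideal.axioms(1))
    ultimately show "x \<in> I <+>\<^bsub>R\<^esub> J" unfolding set_add_def' by blast
  qed
  finally show ?thesis using assms(1) unfolding W_tilde_def by blast
qed

section \<open>Torsion submodules\<close>

lemma gamma_set_subset: "gamma_set R c M \<subseteq> carrier M"
  unfolding gamma_set_def by blast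

lemma mem_gamma_set_iff:
  "x \<in> gamma_set R c M \<longleftrightarrow>
    x \<in> carrier M \<and> (\<exists>n\<ge>1. \<forall>a\<in>ideal_power R c n. a \<odot>\<^bsub>M\<^esub> x = \<zero>\<^bsub>M\<^esub>)"
  by (simp add: gamma_set_def)

lemma (in cring) gamma_set_antimono: "d \<subseteq> c \<Longrightarrow> gamma_set R c M \<subseteq> gamma_set R d M"
  unfolding gamma_set_def using ideal_power_mono by blast

lemma gamma_set_submodule:
  fixes M :: "('r, 'e) gr_module"
  assumes "module R M" "ideal c R"
  shows "submodule (gamma_set R c M) R M"
proof -
  interpret module R M by fact
  have carr: "a \<in> carrier R" if "a \<in> ideal_power R c n" for a n
    using that R.ideal_power_carr[OF assms(2)] by blast
  show ?thesis
  proof (rule submoduleI)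
    show "gamma_set R c M \<subseteq> carrier M" by (rule gamma_set_subset)
    show "\<zero>\<^bsub>M\<^esub> \<in> gamma_set R c M"
      unfolding mem_gamma_set_iff using carr by (auto intro!: exI[of _ 1] simp del: One_nat_def)
    fix x assume "x \<in> gamma_set R c M"
    then obtain n where x: "x \<in> carrier M" "n \<ge> 1" "\<And>a. a \<in> ideal_power R c n \<Longrightarrow> a \<odot>\<^bsub>M\<^esub> x = \<zero>\<^bsub>M\<^esub>"
      unfolding mem_gamma_set_iff by blast
    show "\<ominus>\<^bsub>M\<^esub> x \<in> gamma_set R c M"
      unfolding mem_gamma_set_iff
    proof (intro conjI exI ballI)
      show "a \<odot>\<^bsub>M\<^esub> (\<ominus>\<^bsub>M\<^esub> x) = \<zero>\<^bsub>M\<^esub>" if "a \<in> ideal_power R c n" for a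
        using x(1) x(3)[OF that] carr[OF that] by (simp add: smult_r_minus)
    qed (use x in simp_all)
    show "r \<odot>\<^bsub>M\<^esub> x \<in> gamma_set R c M" if r: "r \<in> carrier R" for r
      unfolding mem_gamma_set_iff
    proof (intro conjI exI ballI)
      show "a \<odot>\<^bsub>M\<^esub> (r \<odot>\<^bsub>M\<^esub> x) = \<zero>\<^bsub>M\<^esub>" if "a \<in> ideal_power R c n" for a
        using smult_left_commute[OF carr[OF that] r x(1)] x(3)[OF that] r by simp
    qed (use x r in simp_all)
    fix y assume "y \<in> gamma_set R c M"
    then obtain m where y: "y \<in> carrier M" "m \<ge> 1" "\<And>a. a \<in> ideal_power R c m \<Longrightarrow> a \<odot>\<^bsub>M\<^esub> y = \<zero>\<^bsub>M\<^esub>"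
      unfolding mem_gamma_set_iff by blast
    show "x \<oplus>\<^bsub>M\<^esub> y \<in> gamma_set R c M"
      unfolding mem_gamma_set_iff
    proof (intro conjI exI ballI)
      fix a assume a: "a \<in> ideal_power R c (max n m)"
      have "a \<in> ideal_power R c n" "a \<in> ideal_power R c m"
        using a R.ideal_power_antimono[OF assms(2)] max.cobounded1 max.cobounded2 by blast+
      then show "a \<odot>\<^bsub>M\<^esub> (x \<oplus>\<^bsub>M\<^esub> y) = \<zero>\<^bsub>M\<^esub>"
        using x(1,3) y(1,3) carr[OF a] by (simp add: smult_r_distr)
    qed (use x y in auto)
  qed
qed

lemma gr_hom_gamma_set:
  fixes A :: "('r, 'e) gr_module" and B :: "('r, 'f) gr_module"
  assumes "module R A" "module R B" "gr_hom R A B f" "ideal c R"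
  shows "f ` gamma_set R c A \<subseteq> gamma_set R c B"
proof (rule image_subsetI)
  interpret A: module R A by fact
  interpret f: abelian_group_hom A B f by (rule gr_hom_abelian_group_hom[OF assms(1-3)])
  fix x assume "x \<in> gamma_set R c A"
  then obtain n where x: "x \<in> carrier A" "n \<ge> 1" "\<And>a. a \<in> ideal_power R c n \<Longrightarrow> a \<odot>\<^bsub>A\<^esub> x = \<zero>\<^bsub>A\<^esub>"
    unfolding mem_gamma_set_iff by blast
  show "f x \<in> gamma_set R c B"
    unfolding mem_gamma_set_iff
  proof (intro conjI exI ballI)
    fix a assume a: "a \<in> ideal_power R c n"
    have "f (a \<odot>\<^bsub>A\<^esub> x) = \<zero>\<^bsub>B\<^esub>" using x(3)[OF a] f.hom_zero by simp
    then show "a \<odot>\<^bsub>B\<^esub> f x = \<zero>\<^bsub>B\<^esub>"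
      using gr_hom_smult[OF assms(3) A.R.ideal_power_carr[OF assms(4) a] x(1)] by simp
  qed (use x in simp_all)
qed

text \<open>If \<open>I^n x\<close> lies in \<open>J x\<close>, each element of \<open>I^n\<close>
  differs from an element of \<open>J\<close> by an annihilator of \<open>x\<close>, and
  annihilators lie in \<open>c\<close>. Conversely, \<open>I^m\<close> inside \<open>c + J\<close>
  gives \<open>I^(m n)\<close> inside \<open>c^n + J\<close>, where the part from \<open>c^n\<close>
  kills \<open>x\<close>.\<close>

lemma gamma_pair_set_eq_Union:
  fixes M :: "('r, 'e) gr_module"
  assumes "graded_module R M" "ideal I R" "ideal J R"
  shows "gamma_pair_set R I J M = (\<Union>c\<in>W_tilde R I J. gamma_set R c M)"
proof (intro equalityI subsetI)
  interpret graded_module R M by fact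
  fix x assume "x \<in> gamma_pair_set R I J M"
  then obtain n where x: "x \<in> carrier M" and n: "n \<ge> 1"
    "(\<lambda>a. a \<odot>\<^bsub>M\<^esub> x) ` ideal_power R I n \<subseteq> (\<lambda>a. a \<odot>\<^bsub>M\<^esub> x) ` J"
    unfolding gamma_pair_set_def by blast
  obtain c m where c: "homogeneous_ideal R c" "{a \<in> carrier R. a \<odot>\<^bsub>M\<^esub> x = \<zero>\<^bsub>M\<^esub>} \<subseteq> c"
      "\<forall>a\<in>ideal_power R c (Suc m). a \<odot>\<^bsub>M\<^esub> x = \<zero>\<^bsub>M\<^esub>"
    using annihilator_subset_nilpotent_homogeneous_ideal[OF x] by blast
  have "ideal_power R I n \<subseteq> c <+>\<^bsub>R\<^esub> J"
  proof
    fix a assume a: "a \<in> ideal_power R I n"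
    then obtain b where b: "b \<in> J" "a \<odot>\<^bsub>M\<^esub> x = b \<odot>\<^bsub>M\<^esub> x" using n(2) by blast
    have carr: "a \<in> carrier R" "b \<in> carrier R"
      using R.ideal_power_carr[OF assms(2) a] ideal.Icarr[OF assms(3) b(1)] by blast+
    have "(a \<ominus>\<^bsub>R\<^esub> b) \<odot>\<^bsub>M\<^esub> x = \<zero>\<^bsub>M\<^esub>"
      using carr x b(2) by (simp add: R.minus_eq smult_l_distr smult_l_minus M.r_neg)
    then have "a \<ominus>\<^bsub>R\<^esub> b \<in> c" using c(2) carr by blast
    moreover have "a = (a \<ominus>\<^bsub>R\<^esub> b) \<oplus>\<^bsub>R\<^esub> b" using carr by (simp add: R.minus_eq R.a_assoc R.l_neg)
    ultimately show "a \<in> c <+>\<^bsub>R\<^esub> J" using b(1) unfolding set_add_def' by blast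
  qed
  then have "c \<in> W_tilde R I J" using c(1) n(1) unfolding W_tilde_def by blast
  moreover have "x \<in> gamma_set R c M"
    unfolding mem_gamma_set_iff using x c(3) by (intro conjI exI[of _ "Suc m"]) simp_all
  ultimately show "x \<in> (\<Union>c\<in>W_tilde R I J. gamma_set R c M)" by blast
next
  interpret graded_module R M by fact
  fix x assume "x \<in> (\<Union>c\<in>W_tilde R I J. gamma_set R c M)"
  then obtain c where c: "c \<in> W_tilde R I J" "x \<in> gamma_set R c M" by blast
  obtain n where n: "n \<ge> 1" "\<And>a. a \<in> ideal_power R c n \<Longrightarrow> a \<odot>\<^bsub>M\<^esub> x = \<zero>\<^bsub>M\<^esub>" and x: "x \<in> carrier M"
    using c(2) unfolding mem_gamma_set_iff by blast
  obtain m where m: "m \<ge> 1" "ideal_power R I m \<subseteq> c <+>\<^bsub>R\<^esub> J" using c(1) unfolding W_tilde_def by blast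
  have ci: "ideal c R" using W_tilde_ideal[OF c(1)] .
  have "ideal_power R I (m * n) \<subseteq> ideal_power R c n <+>\<^bsub>R\<^esub> J"
    unfolding R.ideal_power_mult[OF assms(2)]
    using R.ideal_power_add_subset[OF R.ideal_ideal_power[OF assms(2)] ci assms(3) m(2)] .
  have "a \<odot>\<^bsub>M\<^esub> x \<in> (\<lambda>a. a \<odot>\<^bsub>M\<^esub> x) ` J" if "a \<in> ideal_power R I (m * n)" for a
  proof -
    have "a \<in> ideal_power R c n <+>\<^bsub>R\<^esub> J"
      using that \<open>ideal_power R I (m * n) \<subseteq> ideal_power R c n <+>\<^bsub>R\<^esub> J\<close> by blast
    then obtain p j where p: "p \<in> ideal_power R c n" "j \<in> J" "a = p \<oplus>\<^bsub>R\<^esub> j" unfolding set_add_def' by blast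
    have carr: "p \<in> carrier R" "j \<in> carrier R"
      using R.ideal_power_carr[OF ci p(1)] ideal.Icarr[OF assms(3) p(2)] by blast+
    have "a \<odot>\<^bsub>M\<^esub> x = j \<odot>\<^bsub>M\<^esub> x" using p n(2) carr x by (simp add: smult_l_distr)
    then show ?thesis using p(2) by blast
  qed
  moreover have "m * n \<ge> 1" using m n by (simp add: Suc_le_eq)
  ultimately show "x \<in> gamma_pair_set R I J M" unfolding gamma_pair_set_def using x by blast
qed

section \<open>Direct limits of subquotients\<close>

text \<open>Transition maps, scalar multiples and induced maps are all encoded as the image of a
  coset plus the target subgroup. This one computation evaluates them, with \<open>g\<close> the
  identity, a scalar or a lift.\<close>

lemma set_add_image_coset:
  assumes "abelian_group A" "abelian_group A'" "additive_subgroup B A" "additive_subgroup B' A'"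
    and g: "\<And>x. x \<in> carrier A \<Longrightarrow> g x \<in> carrier A'"
      "\<And>x y. \<lbrakk>x \<in> carrier A; y \<in> carrier A\<rbrakk> \<Longrightarrow> g (x \<oplus>\<^bsub>A\<^esub> y) = g x \<oplus>\<^bsub>A'\<^esub> g y"
    and "g ` B \<subseteq> B'" "z \<in> carrier A"
  shows "B' <+>\<^bsub>A'\<^esub> g ` (B +>\<^bsub>A\<^esub> z) = B' +>\<^bsub>A'\<^esub> g z"
proof -
  interpret A: abelian_group A by fact
  interpret A': abelian_group A' by fact
  interpret B: additive_subgroup B A by fact
  interpret B': additive_subgroup B' A' by fact
  show ?thesis
  proof (intro equalityI subsetI)
    fix y assume "y \<in> B' <+>\<^bsub>A'\<^esub> g ` (B +>\<^bsub>A\<^esub> z)"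
    then obtain b' b where b: "b' \<in> B'" "b \<in> B" and y: "y = b' \<oplus>\<^bsub>A'\<^esub> g (b \<oplus>\<^bsub>A\<^esub> z)"
      unfolding set_add_def' a_r_coset_def' by blast
    have "y = (b' \<oplus>\<^bsub>A'\<^esub> g b) \<oplus>\<^bsub>A'\<^esub> g z"
      using b assms(8) g y B.a_Hcarr B'.a_Hcarr by (simp add: A'.a_assoc)
    moreover have "b' \<oplus>\<^bsub>A'\<^esub> g b \<in> B'" using b assms(7) by blast
    ultimately show "y \<in> B' +>\<^bsub>A'\<^esub> g z" unfolding a_r_coset_def' by blast
  next
    fix y assume "y \<in> B' +>\<^bsub>A'\<^esub> g z"
    then obtain b' where b: "b' \<in> B'" and y: "y = b' \<oplus>\<^bsub>A'\<^esub> g z"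
      unfolding a_r_coset_def' by blast
    have "y = b' \<oplus>\<^bsub>A'\<^esub> g (\<zero>\<^bsub>A\<^esub> \<oplus>\<^bsub>A\<^esub> z)" using y assms(8) by simp
    then show "y \<in> B' <+>\<^bsub>A'\<^esub> g ` (B +>\<^bsub>A\<^esub> z)"
      unfolding set_add_def' a_r_coset_def' using b B.zero_closed by blast
  qed
qed

text \<open>The quotient \<open>Z / B\<close> inside \<open>A\<close>. Cohomology has this shape,
  and a fixed ambient \<open>A\<close> allows \<open>Z\<close> and \<open>B\<close> to vary with the
  index.\<close>

definition subquotient ::
    "('r, 'e) gr_module \<Rightarrow> 'e set \<Rightarrow> 'e set \<Rightarrow> ('r, 'e set) gr_module" where
  "subquotient A Z B =
     \<lparr> carrier = {B +>\<^bsub>A\<^esub> z | z. z \<in> Z},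
       mult = undefined, one = undefined,
       zero = B,
       add = set_add A,
       smult = (\<lambda>r X. B <+>\<^bsub>A\<^esub> ((\<lambda>x. r \<odot>\<^bsub>A\<^esub> x) ` X)),
       mcomp = (\<lambda>k. {B +>\<^bsub>A\<^esub> z | z. z \<in> Z \<inter> mcomp A k}) \<rparr>"

lemma cohomology_eq_subquotient:
  "cohomology C d n =
     subquotient (C n) (a_kernel (C n) (C (Suc n)) (d n)) (coboundaries C d n)"
  by (simp add: cohomology_def subquotient_def Let_def)

text \<open>For \<open>X\<close> a coset of the union of the \<open>B c\<close>, this set turns out to be an equivalence class in
  the direct limit; it is the image of \<open>X\<close> under the isomorphism.\<close>

definition colimit_class :: "'i set \<Rightarrow> ('r, 'e) gr_module \<Rightarrow> ('i \<Rightarrow> 'e set) \<Rightarrow> ('i \<Rightarrow> 'e set) \<Rightarrow>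
    'e set \<Rightarrow> ('i \<times> 'e set) set" where
  "colimit_class W A Z B X = {(c, B c +>\<^bsub>A\<^esub> z) | c z. c \<in> W \<and> z \<in> Z c \<and> z \<in> X}"

text \<open>All terms live in one module, so the transition maps are induced by the identity of
  \<open>A\<close> and eventual equality can be tested on representatives.\<close>

locale subquotient_system = module R A
  for R :: "('r, 'c) ring_scheme" and A :: "('r, 'e) gr_module" +
  fixes W :: "'i set" and leq :: "'i \<Rightarrow> 'i \<Rightarrow> bool" and Z B :: "'i \<Rightarrow> 'e set"
  assumes Z_submodule: "c \<in> W \<Longrightarrow> submodule (Z c) R A"
    and B_submodule: "c \<in> W \<Longrightarrow> submodule (B c) R A"
    and B_subset_Z: "c \<in> W \<Longrightarrow> B c \<subseteq> Z c"
    and Z_mono: "\<lbrakk>c \<in> W; d \<in> W; leq c d\<rbrakk> \<Longrightarrow> Z c \<subseteq> Z d"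
    and B_mono: "\<lbrakk>c \<in> W; d \<in> W; leq c d\<rbrakk> \<Longrightarrow> B c \<subseteq> B d"
    and directed: "\<lbrakk>c \<in> W; d \<in> W\<rbrakk> \<Longrightarrow> \<exists>e\<in>W. leq c e \<and> leq d e"
    and leq_trans: "\<lbrakk>leq c d; leq d e\<rbrakk> \<Longrightarrow> leq c e"
    and W_nonempty: "W \<noteq> {}"
begin

abbreviation "term_at c \<equiv> subquotient A (Z c) (B c)"
abbreviation "transition c d X \<equiv> B d <+>\<^bsub>A\<^esub> X"
abbreviation "UZ \<equiv> \<Union>c\<in>W. Z c"
abbreviation "UB \<equiv> \<Union>c\<in>W. B c"
abbreviation "rel \<equiv> eventually_equal W leq term_at transition"
abbreviation "cls \<equiv> colimit_class W A Z B"

lemma Z_carr: "c \<in> W \<Longrightarrow> z \<in> Z c \<Longrightarrow> z \<in> carrier A"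
  using Z_submodule submoduleE(1) by blast

lemma B_abelian_subgroup: "c \<in> W \<Longrightarrow> abelian_subgroup (B c) A"
  using B_submodule submodule_additive_subgroup M.abelian_group_axioms abelian_subgroupI3 by blast

lemma UB_submodule: "submodule UB R A"
proof (rule submoduleI)
  show "UB \<subseteq> carrier A" using B_submodule submoduleE(1) by blast
  show "\<zero>\<^bsub>A\<^esub> \<in> UB"
    using W_nonempty B_abelian_subgroup additive_subgroup.zero_closed
      abelian_subgroup.axioms(1) by fastforce
  show "\<ominus>\<^bsub>A\<^esub> a \<in> UB" if "a \<in> UB" for a
    using that B_submodule submoduleE(3) by blast
  show "r \<odot>\<^bsub>A\<^esub> a \<in> UB" if "r \<in> carrier R" "a \<in> UB" for r a
    using that B_submodule submoduleE(4) by blast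
  fix a b assume "a \<in> UB" "b \<in> UB"
  then obtain c d where cd: "c \<in> W" "a \<in> B c" "d \<in> W" "b \<in> B d" by blast
  then obtain e where e: "e \<in> W" "leq c e" "leq d e" using directed by blast
  then have "a \<in> B e" "b \<in> B e" using cd B_mono by blast+
  then show "a \<oplus>\<^bsub>A\<^esub> b \<in> UB" using e B_submodule submoduleE(5) by blast
qed

lemma UB_abelian_subgroup: "abelian_subgroup UB A"
  using UB_submodule submodule_additive_subgroup M.abelian_group_axioms abelian_subgroupI3 by blast

lemma UZ_carr: "z \<in> UZ \<Longrightarrow> z \<in> carrier A"
  using Z_carr by blast

lemma coset_eq_iff:
  assumes "abelian_subgroup H A" "z \<in> carrier A" "w \<in> carrier A"
  shows "H +>\<^bsub>A\<^esub> z = H +>\<^bsub>A\<^esub> w \<longleftrightarrow> z \<ominus>\<^bsub>A\<^esub> w \<in> H"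
proof -
  interpret H: abelian_subgroup H A by fact
  show ?thesis
    using assms(2,3) H.a_repr_independence'[of z w] H.a_repr_independenceD[of z w]
      H.a_rcos_module[of w z] H.a_rcos_self
    by (metis M.minus_eq)
qed

lemma transition_coset:
  assumes "c \<in> W" "d \<in> W" "leq c d" "z \<in> Z c"
  shows "transition c d (B c +>\<^bsub>A\<^esub> z) = B d +>\<^bsub>A\<^esub> z"
  using set_add_image_coset[of A A "B c" "B d" "\<lambda>x. x" z, OF M.abelian_group_axioms M.abelian_group_axioms
      abelian_subgroup.axioms(1)[OF B_abelian_subgroup] abelian_subgroup.axioms(1)[OF B_abelian_subgroup]]
    assms B_mono Z_carr by simp

text \<open>Representatives are identified at the stage \<open>e\<close> exactly when their
  difference lies in \<open>B e\<close>; over all stages this means that it lies in the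
  union.\<close>

lemma rel_iff:
  assumes "c \<in> W" "d \<in> W" "z \<in> Z c" "w \<in> Z d"
  shows "((c, B c +>\<^bsub>A\<^esub> z), (d, B d +>\<^bsub>A\<^esub> w)) \<in> rel \<longleftrightarrow> UB +>\<^bsub>A\<^esub> z = UB +>\<^bsub>A\<^esub> w"
proof -
  have carr: "z \<in> carrier A" "w \<in> carrier A" using assms Z_carr by blast+
  have "((c, B c +>\<^bsub>A\<^esub> z), (d, B d +>\<^bsub>A\<^esub> w)) \<in> rel \<longleftrightarrow>
      (\<exists>e\<in>W. leq c e \<and> leq d e \<and> B e +>\<^bsub>A\<^esub> z = B e +>\<^bsub>A\<^esub> w)"
    (is "_ = ?R")
  proof -
    have "((c, B c +>\<^bsub>A\<^esub> z), (d, B d +>\<^bsub>A\<^esub> w)) \<in> rel \<longleftrightarrow> (\<exists>e\<in>W. leq c e \<and> leq d e \<and>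
        transition c e (B c +>\<^bsub>A\<^esub> z) = transition d e (B d +>\<^bsub>A\<^esub> w))"
      unfolding eventually_equal_def subquotient_def using assms by auto
    also have "\<dots> \<longleftrightarrow> ?R" using assms transition_coset by (metis (no_types, lifting))
    finally show ?thesis .
  qed
  also have "\<dots> \<longleftrightarrow> (\<exists>e\<in>W. leq c e \<and> leq d e \<and> z \<ominus>\<^bsub>A\<^esub> w \<in> B e)"
    using coset_eq_iff[OF B_abelian_subgroup carr] by blast
  also have "\<dots> \<longleftrightarrow> z \<ominus>\<^bsub>A\<^esub> w \<in> UB"
  proof
    assume "z \<ominus>\<^bsub>A\<^esub> w \<in> UB"
    then obtain f where f: "f \<in> W" "z \<ominus>\<^bsub>A\<^esub> w \<in> B f" by blast
    obtain e where e: "e \<in> W" "leq c e" "leq d e" using directed assms by blast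
    \<comment> \<open>The stage \<open>f\<close> at which the difference enters need not lie above
      \<open>c\<close> and \<open>d\<close>, so directedness is used a second time.\<close>
    obtain g where g: "g \<in> W" "leq e g" "leq f g" using directed e f by blast
    have "leq c g" "leq d g" using e g leq_trans by blast+
    moreover have "z \<ominus>\<^bsub>A\<^esub> w \<in> B g" using f g B_mono by blast
    ultimately show "\<exists>e\<in>W. leq c e \<and> leq d e \<and> z \<ominus>\<^bsub>A\<^esub> w \<in> B e" using g by blast
  qed blast
  also have "\<dots> \<longleftrightarrow> UB +>\<^bsub>A\<^esub> z = UB +>\<^bsub>A\<^esub> w"
    using coset_eq_iff[OF UB_abelian_subgroup carr] by simp
  finally show ?thesis .
qed

lemma mem_cls_iff: "p \<in> cls X \<longleftrightarrow> (\<exists>c z. p = (c, B c +>\<^bsub>A\<^esub> z) \<and> c \<in> W \<and> z \<in> Z c \<and> z \<in> X)"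
  unfolding colimit_class_def by blast

lemmas clsD = mem_cls_iff[THEN iffD1]

lemma clsI: "\<lbrakk>c \<in> W; z \<in> Z c; z \<in> X\<rbrakk> \<Longrightarrow> (c, B c +>\<^bsub>A\<^esub> z) \<in> cls X"
  unfolding mem_cls_iff by blast

lemma mem_UB_coset_iff:
  "\<lbrakk>z \<in> carrier A; w \<in> carrier A\<rbrakk> \<Longrightarrow> w \<in> UB +>\<^bsub>A\<^esub> z \<longleftrightarrow> UB +>\<^bsub>A\<^esub> z = UB +>\<^bsub>A\<^esub> w"
  using UB_abelian_subgroup abelian_subgroup.a_repr_independence'
    abelian_subgroup.a_repr_independenceD by metis

lemma rel_Image_singleton:
  assumes "c \<in> W" "z \<in> Z c"
  shows "rel `` {(c, B c +>\<^bsub>A\<^esub> z)} = cls (UB +>\<^bsub>A\<^esub> z)"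
proof (intro equalityI subsetI)
  fix p assume "p \<in> rel `` {(c, B c +>\<^bsub>A\<^esub> z)}"
  then have p: "((c, B c +>\<^bsub>A\<^esub> z), p) \<in> rel" by blast
  then obtain d w where d: "d \<in> W" "w \<in> Z d" "p = (d, B d +>\<^bsub>A\<^esub> w)"
    unfolding eventually_equal_def subquotient_def by auto
  then have "UB +>\<^bsub>A\<^esub> z = UB +>\<^bsub>A\<^esub> w" using p rel_iff assms by blast
  then have "w \<in> UB +>\<^bsub>A\<^esub> z" using mem_UB_coset_iff assms d Z_carr by blast
  then show "p \<in> cls (UB +>\<^bsub>A\<^esub> z)" using d clsI by simp
next
  fix p assume "p \<in> cls (UB +>\<^bsub>A\<^esub> z)"
  then obtain d w where d: "d \<in> W" "w \<in> Z d" "p = (d, B d +>\<^bsub>A\<^esub> w)" "w \<in> UB +>\<^bsub>A\<^esub> z"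
    using clsD by blast
  then have "UB +>\<^bsub>A\<^esub> z = UB +>\<^bsub>A\<^esub> w" using mem_UB_coset_iff assms Z_carr by blast
  then show "p \<in> rel `` {(c, B c +>\<^bsub>A\<^esub> z)}" using rel_iff assms d by blast
qed

lemma cls_self: "\<lbrakk>c \<in> W; z \<in> Z c\<rbrakk> \<Longrightarrow> (c, B c +>\<^bsub>A\<^esub> z) \<in> cls (UB +>\<^bsub>A\<^esub> z)"
  using mem_UB_coset_iff[of z z] Z_carr[of c z] clsI by simp

text \<open>Sums and multiples in the limit are defined by saturating a whole set of
  representatives. Such a set yields a single class once it is nonempty and stays inside that
  class.\<close>

lemma rel_Image_subset:
  assumes "S \<subseteq> cls (UB +>\<^bsub>A\<^esub> z)" "S \<noteq> {}" "z \<in> UZ"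
  shows "rel `` S = cls (UB +>\<^bsub>A\<^esub> z)"
proof -
  have "rel `` {p} = cls (UB +>\<^bsub>A\<^esub> z)" if "p \<in> S" for p
  proof -
    obtain c w where w: "p = (c, B c +>\<^bsub>A\<^esub> w)" "c \<in> W" "w \<in> Z c" "w \<in> UB +>\<^bsub>A\<^esub> z"
      using clsD[OF subsetD[OF assms(1) \<open>p \<in> S\<close>]] by blast
    have "UB +>\<^bsub>A\<^esub> z = UB +>\<^bsub>A\<^esub> w"
      using mem_UB_coset_iff[OF UZ_carr[OF assms(3)] Z_carr[OF w(2,3)]] w(4) by simp
    then show ?thesis using rel_Image_singleton[OF w(2,3)] w(1) by simp
  qed
  then show ?thesis using assms(2) by blast
qed

lemma inj_on_cls: "inj_on cls {UB +>\<^bsub>A\<^esub> z | z. z \<in> UZ}"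
proof (rule inj_onI)
  fix X Y
  assume "X \<in> {UB +>\<^bsub>A\<^esub> z | z. z \<in> UZ}" "Y \<in> {UB +>\<^bsub>A\<^esub> z | z. z \<in> UZ}" "cls X = cls Y"
  then obtain c z d w where *: "cls (UB +>\<^bsub>A\<^esub> z) = cls (UB +>\<^bsub>A\<^esub> w)"
      "c \<in> W" "z \<in> Z c" "d \<in> W" "w \<in> Z d" and XY: "X = UB +>\<^bsub>A\<^esub> z" "Y = UB +>\<^bsub>A\<^esub> w"
    by blast
  then have "rel `` {(c, B c +>\<^bsub>A\<^esub> z)} = rel `` {(d, B d +>\<^bsub>A\<^esub> w)}"
    using rel_Image_singleton[OF *(2,3)] rel_Image_singleton[OF *(4,5)] by simp
  moreover have "((d, B d +>\<^bsub>A\<^esub> w), (d, B d +>\<^bsub>A\<^esub> w)) \<in> rel"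
    using rel_iff * by blast
  ultimately have "((c, B c +>\<^bsub>A\<^esub> z), (d, B d +>\<^bsub>A\<^esub> w)) \<in> rel" by blast
  then show "X = Y" using rel_iff * XY by blast
qed

lemma Z_coset_subset: "\<lbrakk>c \<in> W; z \<in> Z c\<rbrakk> \<Longrightarrow> B c +>\<^bsub>A\<^esub> z \<subseteq> Z c"
  unfolding a_r_coset_def' using B_subset_Z submoduleE(5)[OF Z_submodule] by blast

text \<open>An element of some \<open>B c\<close> and one of some \<open>Z d\<close> are added at a
  common stage. Because of this containment a map that is known only on the \<open>Z c\<close> can
  be evaluated on a full coset.\<close>

lemma UZ_coset_subset:
  assumes "z \<in> UZ"
  shows "UB +>\<^bsub>A\<^esub> z \<subseteq> UZ"
proof
  fix x assume "x \<in> UB +>\<^bsub>A\<^esub> z"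
  then obtain c b where b: "c \<in> W" "b \<in> B c" "x = b \<oplus>\<^bsub>A\<^esub> z" unfolding a_r_coset_def' by blast
  obtain d where d: "d \<in> W" "z \<in> Z d" using assms by blast
  obtain e where e: "e \<in> W" "leq c e" "leq d e" using directed b d by blast
  have "b \<in> Z e" "z \<in> Z e" using b d e B_subset_Z Z_mono by blast+
  then show "x \<in> UZ" using submoduleE(5)[OF Z_submodule] e b by blast
qed

abbreviation "lim \<equiv> direct_limit W leq term_at transition"

lemma smult_coset:
  assumes "abelian_subgroup H A" "\<And>x. x \<in> H \<Longrightarrow> r \<odot>\<^bsub>A\<^esub> x \<in> H" "r \<in> carrier R" "z \<in> carrier A"
  shows "H <+>\<^bsub>A\<^esub> (\<lambda>x. r \<odot>\<^bsub>A\<^esub> x) ` (H +>\<^bsub>A\<^esub> z) = H +>\<^bsub>A\<^esub> (r \<odot>\<^bsub>A\<^esub> z)"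
  using assms abelian_subgroup.axioms(1) M.abelian_group_axioms
  by (intro set_add_image_coset) (auto simp: smult_r_distr)

lemma add_upper_bound:
  assumes "c \<in> W" "z \<in> Z c" "d \<in> W" "w \<in> Z d" "e \<in> W" "leq c e" "leq d e"
  shows "z \<oplus>\<^bsub>A\<^esub> w \<in> Z e"
proof -
  have "z \<in> Z e" using Z_mono[of c e] assms by blast
  moreover have "w \<in> Z e" using Z_mono[of d e] assms by blast
  ultimately show ?thesis by (rule submoduleE(5)[OF Z_submodule[OF \<open>e \<in> W\<close>]])
qed

lemma add_transition:
  assumes "c \<in> W" "z \<in> Z c" "d \<in> W" "w \<in> Z d" "e \<in> W" "leq c e" "leq d e"
  shows "transition c e (B c +>\<^bsub>A\<^esub> z) \<oplus>\<^bsub>term_at e\<^esub> transition d e (B d +>\<^bsub>A\<^esub> w) =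
    B e +>\<^bsub>A\<^esub> (z \<oplus>\<^bsub>A\<^esub> w)"
  using transition_coset[OF assms(1,5,6,2)] transition_coset[OF assms(3,5,7,4)]
    abelian_subgroup.a_rcos_sum[OF B_abelian_subgroup[OF assms(5)] Z_carr[OF assms(1,2)] Z_carr[OF assms(3,4)]]
  by (simp add: subquotient_def)

lemma add_mem_UB_coset:
  assumes "z \<in> carrier A" "w \<in> carrier A" "z' \<in> UB +>\<^bsub>A\<^esub> z" "w' \<in> UB +>\<^bsub>A\<^esub> w"
  shows "z' \<oplus>\<^bsub>A\<^esub> w' \<in> UB +>\<^bsub>A\<^esub> (z \<oplus>\<^bsub>A\<^esub> w)"
proof -
  have "z' \<oplus>\<^bsub>A\<^esub> w' \<in> (UB +>\<^bsub>A\<^esub> z) <+>\<^bsub>A\<^esub> (UB +>\<^bsub>A\<^esub> w)"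
    using assms(3,4) unfolding set_add_def' by blast
  then show ?thesis
    unfolding abelian_subgroup.a_rcos_sum[OF UB_abelian_subgroup assms(1,2)] .
qed

text \<open>A coset of the union of the \<open>B c\<close> and its class in the limit have the same
  representatives, which gives bijectivity. On both sides, degree \<open>k\<close> means having a
  representative of degree \<open>k\<close> in \<open>A\<close>.\<close>

lemma gr_iso_colimit_class: "gr_iso R (subquotient A UZ UB) lim cls"
proof -
  \<comment> \<open>\<open>Q\<close> will be everything for the carrier and \<open>mcomp A k\<close>
    for the part of degree \<open>k\<close>.\<close>
  have rel_classes: "{rel `` {(c, B c +>\<^bsub>A\<^esub> z)} | c z. c \<in> W \<and> z \<in> Z c \<inter> Q} = cls ` {UB +>\<^bsub>A\<^esub> z | z. z \<in> UZ \<inter> Q}" (is "?L = ?R") for Q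
  proof (intro equalityI subsetI)
    fix P assume "P \<in> ?L"
    then obtain c z where z: "c \<in> W" "z \<in> Z c" "z \<in> Q" "P = rel `` {(c, B c +>\<^bsub>A\<^esub> z)}" by blast
    then have "P = cls (UB +>\<^bsub>A\<^esub> z)" using rel_Image_singleton by simp
    then show "P \<in> ?R" using z(1-3) by blast
  next
    fix P assume "P \<in> ?R"
    then obtain c z where z: "c \<in> W" "z \<in> Z c" "z \<in> Q" "P = cls (UB +>\<^bsub>A\<^esub> z)" by blast
    then have "P = rel `` {(c, B c +>\<^bsub>A\<^esub> z)}" using rel_Image_singleton by simp
    then show "P \<in> ?L" using z(1-3) by blast
  qed
  have carrier_lim: "carrier lim = cls ` {UB +>\<^bsub>A\<^esub> z | z. z \<in> UZ}"
  proof -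
    have "carrier lim = {rel `` {(c, B c +>\<^bsub>A\<^esub> z)} | c z. c \<in> W \<and> z \<in> Z c}"
      unfolding direct_limit_def Let_def quotient_def by (auto simp: subquotient_def)
    then show ?thesis using rel_classes[of UNIV] by simp
  qed
  have mcomp_lim: "mcomp lim k = cls ` {UB +>\<^bsub>A\<^esub> z | z. z \<in> UZ \<inter> mcomp A k}" for k
  proof -
    have "mcomp lim k = {rel `` {(c, B c +>\<^bsub>A\<^esub> z)} | c z. c \<in> W \<and> z \<in> Z c \<inter> mcomp A k}"
      unfolding direct_limit_def Let_def by (auto simp: subquotient_def)
    then show ?thesis using rel_classes[of "mcomp A k"] by simp
  qed
  have add_lim: "cls (UB +>\<^bsub>A\<^esub> z) \<oplus>\<^bsub>lim\<^esub> cls (UB +>\<^bsub>A\<^esub> w) = cls (UB +>\<^bsub>A\<^esub> (z \<oplus>\<^bsub>A\<^esub> w))" if zw: "z \<in> UZ" "w \<in> UZ" for z w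
  proof -
    \<comment> \<open>The set that the definition of addition in the limit saturates: all
      representatives and all upper bounds occur at once.\<close>
    let ?S = "{(e, transition c e x \<oplus>\<^bsub>term_at e\<^esub> transition d e y) | c x d y e.
        (c, x) \<in> cls (UB +>\<^bsub>A\<^esub> z) \<and> (d, y) \<in> cls (UB +>\<^bsub>A\<^esub> w) \<and> e \<in> W \<and> leq c e \<and> leq d e}"
    obtain c d where cd: "c \<in> W" "z \<in> Z c" "d \<in> W" "w \<in> Z d" using zw by blast
    obtain e where e: "e \<in> W" "leq c e" "leq d e" using cd directed by blast
    have "?S \<subseteq> cls (UB +>\<^bsub>A\<^esub> (z \<oplus>\<^bsub>A\<^esub> w))"
    proof
      fix p assume "p \<in> ?S"
      then obtain c' x d' y e' where p: "p = (e', transition c' e' x \<oplus>\<^bsub>term_at e'\<^esub> transition d' e' y)"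
        "(c', x) \<in> cls (UB +>\<^bsub>A\<^esub> z)" "(d', y) \<in> cls (UB +>\<^bsub>A\<^esub> w)" "e' \<in> W" "leq c' e'" "leq d' e'"
        by blast
      obtain z' where z': "c' \<in> W" "x = B c' +>\<^bsub>A\<^esub> z'" "z' \<in> Z c'" "z' \<in> UB +>\<^bsub>A\<^esub> z"
        using clsD[OF p(2)] by blast
      obtain w' where w': "d' \<in> W" "y = B d' +>\<^bsub>A\<^esub> w'" "w' \<in> Z d'" "w' \<in> UB +>\<^bsub>A\<^esub> w"
        using clsD[OF p(3)] by blast
      note bounds = z'(1,3) w'(1,3) p(4-6)
      have "p = (e', B e' +>\<^bsub>A\<^esub> (z' \<oplus>\<^bsub>A\<^esub> w'))"
        using add_transition[OF bounds] p(1) z'(2) w'(2) by simp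
      then show "p \<in> cls (UB +>\<^bsub>A\<^esub> (z \<oplus>\<^bsub>A\<^esub> w))"
        using clsI[OF p(4) add_upper_bound[OF bounds]
            add_mem_UB_coset[OF Z_carr[OF cd(1,2)] Z_carr[OF cd(3,4)] z'(4) w'(4)]] by simp
    qed
    moreover have "?S \<noteq> {}" using cls_self[of c z] cls_self[of d w] cd e by blast
    moreover have "z \<oplus>\<^bsub>A\<^esub> w \<in> UZ" using add_upper_bound[OF cd e] e(1) by blast
    ultimately have "rel `` ?S = cls (UB +>\<^bsub>A\<^esub> (z \<oplus>\<^bsub>A\<^esub> w))" by (rule rel_Image_subset)
    then show ?thesis by (simp add: direct_limit_def Let_def)
  qed
  have smult_lim: "r \<odot>\<^bsub>lim\<^esub> cls (UB +>\<^bsub>A\<^esub> z) = cls (UB +>\<^bsub>A\<^esub> (r \<odot>\<^bsub>A\<^esub> z))" if z: "z \<in> UZ" and r: "r \<in> carrier R" for z r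
  proof -
    let ?S = "{(c, r \<odot>\<^bsub>term_at c\<^esub> x) | c x. (c, x) \<in> cls (UB +>\<^bsub>A\<^esub> z)}"
    obtain c where c: "c \<in> W" "z \<in> Z c" using z by blast
    have coset: "H +>\<^bsub>A\<^esub> (r \<odot>\<^bsub>A\<^esub> w) = H <+>\<^bsub>A\<^esub> (\<lambda>x. r \<odot>\<^bsub>A\<^esub> x) ` (H +>\<^bsub>A\<^esub> w)"
      if "submodule H R A" "w \<in> carrier A" for H w
      using that smult_coset[of H r w] r submoduleE(4) submodule_additive_subgroup
        abelian_subgroupI3 M.abelian_group_axioms by metis
    have "rel `` ?S = cls (UB +>\<^bsub>A\<^esub> (r \<odot>\<^bsub>A\<^esub> z))"
    proof (rule rel_Image_subset)
      show "?S \<noteq> {}" using cls_self c by blast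
      show "r \<odot>\<^bsub>A\<^esub> z \<in> UZ" using c Z_submodule submoduleE(4) r by blast
      show "?S \<subseteq> cls (UB +>\<^bsub>A\<^esub> (r \<odot>\<^bsub>A\<^esub> z))"
      proof
        fix p assume "p \<in> ?S"
        then obtain d w where p: "p = (d, r \<odot>\<^bsub>term_at d\<^esub> (B d +>\<^bsub>A\<^esub> w))" "d \<in> W" "w \<in> Z d"
            "w \<in> UB +>\<^bsub>A\<^esub> z"
          using clsD by blast
        have carr: "z \<in> carrier A" "w \<in> carrier A" using c p Z_carr by blast+
        have "p = (d, B d +>\<^bsub>A\<^esub> (r \<odot>\<^bsub>A\<^esub> w))"
          using p coset[OF B_submodule] carr by (simp add: subquotient_def)
        moreover have "r \<odot>\<^bsub>A\<^esub> w \<in> Z d" using p Z_submodule submoduleE(4) r by blast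
        moreover have "UB +>\<^bsub>A\<^esub> (r \<odot>\<^bsub>A\<^esub> z) = UB +>\<^bsub>A\<^esub> (r \<odot>\<^bsub>A\<^esub> w)"
          using coset[OF UB_submodule] carr mem_UB_coset_iff[OF carr] p(4) by simp
        then have "r \<odot>\<^bsub>A\<^esub> w \<in> UB +>\<^bsub>A\<^esub> (r \<odot>\<^bsub>A\<^esub> z)"
          using mem_UB_coset_iff[of "r \<odot>\<^bsub>A\<^esub> z" "r \<odot>\<^bsub>A\<^esub> w"] carr r by simp
        ultimately show "p \<in> cls (UB +>\<^bsub>A\<^esub> (r \<odot>\<^bsub>A\<^esub> z))" using p(2) clsI by simp
      qed
    qed
    then show ?thesis by (simp add: direct_limit_def Let_def)
  qed
  have carr: "carrier (subquotient A UZ UB) = {UB +>\<^bsub>A\<^esub> z | z. z \<in> UZ}"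
    and comp: "\<And>k. mcomp (subquotient A UZ UB) k = {UB +>\<^bsub>A\<^esub> z | z. z \<in> UZ \<inter> mcomp A k}"
    by (simp_all add: subquotient_def)
  have add: "(UB +>\<^bsub>A\<^esub> z) \<oplus>\<^bsub>subquotient A UZ UB\<^esub> (UB +>\<^bsub>A\<^esub> w) = UB +>\<^bsub>A\<^esub> (z \<oplus>\<^bsub>A\<^esub> w)"
    if "z \<in> UZ" "w \<in> UZ" for z w
    using abelian_subgroup.a_rcos_sum[OF UB_abelian_subgroup UZ_carr[OF that(1)] UZ_carr[OF that(2)]]
    by (simp add: subquotient_def)
  have smult: "r \<odot>\<^bsub>subquotient A UZ UB\<^esub> (UB +>\<^bsub>A\<^esub> z) = UB +>\<^bsub>A\<^esub> (r \<odot>\<^bsub>A\<^esub> z)"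
    if "z \<in> UZ" "r \<in> carrier R" for z r
    using smult_coset[OF UB_abelian_subgroup _ that(2) UZ_carr[OF that(1)]]
      submoduleE(4)[OF UB_submodule that(2)] by (simp add: subquotient_def)
  have "gr_hom R (subquotient A UZ UB) lim cls"
    unfolding gr_hom_def
  proof (intro conjI ballI allI)
    show "cls \<in> carrier (subquotient A UZ UB) \<rightarrow> carrier lim"
      unfolding carrier_lim carr by (rule funcsetI) (rule imageI)
    show "cls ` mcomp (subquotient A UZ UB) n \<subseteq> mcomp lim n" for n
      unfolding mcomp_lim comp by (rule subset_refl)
    show "cls (X \<oplus>\<^bsub>subquotient A UZ UB\<^esub> Y) = cls X \<oplus>\<^bsub>lim\<^esub> cls Y"
      if X: "X \<in> carrier (subquotient A UZ UB)" "Y \<in> carrier (subquotient A UZ UB)" for X Y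
    proof -
      obtain z w where "z \<in> UZ" "w \<in> UZ" "X = UB +>\<^bsub>A\<^esub> z" "Y = UB +>\<^bsub>A\<^esub> w"
        using X unfolding carr by blast
      then show ?thesis using add add_lim by simp
    qed
    show "cls (r \<odot>\<^bsub>subquotient A UZ UB\<^esub> X) = r \<odot>\<^bsub>lim\<^esub> cls X"
      if r: "r \<in> carrier R" and X: "X \<in> carrier (subquotient A UZ UB)" for r X
    proof -
      obtain z where "z \<in> UZ" "X = UB +>\<^bsub>A\<^esub> z" using X unfolding carr by blast
      then show ?thesis using r smult smult_lim by simp
    qed
  qed
  moreover have "bij_betw cls (carrier (subquotient A UZ UB)) (carrier lim)"
    unfolding bij_betw_def using inj_on_cls carrier_lim carr by simp
  ultimately show ?thesis
    unfolding gr_iso_def using mcomp_lim comp by simp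
qed

text \<open>In the application \<open>h\<close> and the \<open>k c\<close> are restrictions of one
  lift \<open>g\<close> to different torsion submodules. They agree with \<open>g\<close> on the
  respective \<open>Z\<close>, and the cosets involved are contained in these, so all of them can be
  replaced by \<open>g\<close>.\<close>

lemma direct_limit_map_colimit_class:
  assumes system: "subquotient_system R A' W leq Z' B'"
    and g: "\<And>x. x \<in> carrier A \<Longrightarrow> g x \<in> carrier A'"
      "\<And>x y. \<lbrakk>x \<in> carrier A; y \<in> carrier A\<rbrakk> \<Longrightarrow> g (x \<oplus>\<^bsub>A\<^esub> y) = g x \<oplus>\<^bsub>A'\<^esub> g y"
    and gZ: "\<And>c. c \<in> W \<Longrightarrow> g ` Z c \<subseteq> Z' c" and gB: "\<And>c. c \<in> W \<Longrightarrow> g ` B c \<subseteq> B' c"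
    and k: "\<And>c x. \<lbrakk>c \<in> W; x \<in> Z c\<rbrakk> \<Longrightarrow> k c x = g x"
    and h: "\<And>x. x \<in> (\<Union>c\<in>W. Z c) \<Longrightarrow> h x = g x"
    and X: "X \<in> carrier (subquotient A (\<Union>c\<in>W. Z c) (\<Union>c\<in>W. B c))"
  shows "colimit_class W A' Z' B' ((\<Union>c\<in>W. B' c) <+>\<^bsub>A'\<^esub> h ` X) =
    direct_limit_map W leq (\<lambda>c. subquotient A' (Z' c) (B' c)) (\<lambda>c d X. B' d <+>\<^bsub>A'\<^esub> X)
      (\<lambda>c X. B' c <+>\<^bsub>A'\<^esub> k c ` X) (colimit_class W A Z B X)"
proof -
  let ?UB' = "\<Union>c\<in>W. B' c" and ?UZ' = "\<Union>c\<in>W. Z' c"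
  let ?cls' = "colimit_class W A' Z' B'"
  have A': "abelian_group A'"
    using system by (intro module.axioms(2)) (rule subquotient_system.axioms(1))
  note UB' = subquotient_system.UB_abelian_subgroup[OF system]
  note B' = subquotient_system.B_abelian_subgroup[OF system]
  obtain c z where z: "c \<in> W" "z \<in> Z c" "X = UB +>\<^bsub>A\<^esub> z"
    using X by (auto simp: subquotient_def)
  have coset: "H' <+>\<^bsub>A'\<^esub> g ` (H +>\<^bsub>A\<^esub> w) = H' +>\<^bsub>A'\<^esub> g w"
    if "abelian_subgroup H A" "abelian_subgroup H' A'" "g ` H \<subseteq> H'" "w \<in> carrier A" for H H' w
    using set_add_image_coset[of A A' H H' g w] that g abelian_subgroup.axioms(1)
      M.abelian_group_axioms A' by metis
  have XZ: "X \<subseteq> UZ" using UZ_coset_subset z by blast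
  have gX: "?UB' <+>\<^bsub>A'\<^esub> h ` X = ?UB' +>\<^bsub>A'\<^esub> g z"
  proof -
    have "h ` X = g ` X" using h XZ by (meson image_cong subsetD)
    moreover have "g ` UB \<subseteq> ?UB'" using gB by blast
    ultimately show ?thesis
      using coset[OF UB_abelian_subgroup UB' _ Z_carr[OF z(1,2)]] z(3) by simp
  qed
  let ?S = "{(d, B' d <+>\<^bsub>A'\<^esub> k d ` Y) | d Y. (d, Y) \<in> cls X}"
  have "eventually_equal W leq (\<lambda>c. subquotient A' (Z' c) (B' c)) (\<lambda>c d X. B' d <+>\<^bsub>A'\<^esub> X) `` ?S =
      ?cls' (?UB' +>\<^bsub>A'\<^esub> g z)"
  proof (rule subquotient_system.rel_Image_subset[OF system])
    show "?S \<noteq> {}" using cls_self z by blast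
    show "g z \<in> ?UZ'" using gZ z by blast
    show "?S \<subseteq> ?cls' (?UB' +>\<^bsub>A'\<^esub> g z)"
    proof
      fix p assume "p \<in> ?S"
      then obtain d w where p: "p = (d, B' d <+>\<^bsub>A'\<^esub> k d ` (B d +>\<^bsub>A\<^esub> w))" "d \<in> W" "w \<in> Z d"
          "w \<in> UB +>\<^bsub>A\<^esub> z"
        unfolding z(3) using clsD by blast
      have carr: "z \<in> carrier A" "w \<in> carrier A" using z p Z_carr by blast+
      have "B d +>\<^bsub>A\<^esub> w \<subseteq> Z d" using Z_coset_subset p by blast
      then have "k d ` (B d +>\<^bsub>A\<^esub> w) = g ` (B d +>\<^bsub>A\<^esub> w)"
        using k[OF p(2)] by (meson image_cong subsetD)
      then have "p = (d, B' d +>\<^bsub>A'\<^esub> g w)"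
        using coset B_abelian_subgroup B' gB p carr by simp
      moreover have "g w \<in> Z' d" using gZ p by blast
      moreover have "?UB' +>\<^bsub>A'\<^esub> g w = ?UB' +>\<^bsub>A'\<^esub> g z"
      proof -
        have "UB +>\<^bsub>A\<^esub> w = UB +>\<^bsub>A\<^esub> z" using p(4) mem_UB_coset_iff[OF carr] by simp
        moreover have "g ` UB \<subseteq> ?UB'" using gB by blast
        ultimately show ?thesis
          using coset[OF UB_abelian_subgroup UB'] carr by metis
      qed
      then have "g w \<in> ?UB' +>\<^bsub>A'\<^esub> g z"
        using subquotient_system.mem_UB_coset_iff[OF system] carr g(1) by simp
      ultimately show "p \<in> ?cls' (?UB' +>\<^bsub>A'\<^esub> g z)" 
        using p(2) subquotient_system.clsI[OF system] by simp
    qed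
  qed
  then show ?thesis unfolding direct_limit_map_def gX by simp
qed

end

section \<open>Derived functors of subfunctors of the identity\<close>

text \<open>Both torsion functors have this form, so the complexes that compute their derived
  functors are described only once.\<close>

definition sub_functor :: "(('r, 'e) gr_module \<Rightarrow> 'e set) \<Rightarrow> ('r, 'e) gr_functor" where
  "sub_functor S =
     \<lparr> on_obj = (\<lambda>A. gr_submodule A (S A)), on_map = (\<lambda>A B f. restrict f (S A)) \<rparr>"

lemma gamma_eq_sub_functor: "gamma R c = sub_functor (gamma_set R c)"
  and gamma_pair_eq_sub_functor: "gamma_pair R I J = sub_functor (gamma_pair_set R I J)"
  by (simp_all add: gamma_def gamma_pair_def sub_functor_def)

definition sub_cocycles ::
    "('r, 'm, 'e) coresolution \<Rightarrow> (('r, 'e) gr_module \<Rightarrow> 'e set) \<Rightarrow> nat \<Rightarrow> 'e set" where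
  "sub_cocycles E S i =
     {x \<in> S (res_obj E i). res_diff E i x = \<zero>\<^bsub>res_obj E (Suc i)\<^esub>}"

text \<open>Only the part \<open>S\<close> of the preceding term contributes. The result can be
  smaller than the set of coboundaries of the resolution that lie in \<open>S\<close>, and this
  difference is what the cohomology measures.\<close>

definition sub_coboundaries ::
    "('r, 'm, 'e) coresolution \<Rightarrow> (('r, 'e) gr_module \<Rightarrow> 'e set) \<Rightarrow> nat \<Rightarrow> 'e set" where
  "sub_coboundaries E S i =
     (case i of 0 \<Rightarrow> {\<zero>\<^bsub>res_obj E 0\<^esub>} | Suc k \<Rightarrow> res_diff E k ` S (res_obj E k))"

lemma sub_functor_coboundaries:
  "coboundaries (apply_obj (sub_functor S) E) (apply_diff (sub_functor S) E) i = sub_coboundaries E S i"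
  by (auto simp: coboundaries_def sub_coboundaries_def sub_functor_def apply_obj_def apply_diff_def
      gr_submodule_def split: nat.split)

lemma sub_functor_cocycles:
  "a_kernel (apply_obj (sub_functor S) E i) (apply_obj (sub_functor S) E (Suc i)) (apply_diff (sub_functor S) E i)
    = sub_cocycles E S i"
  by (auto simp: mem_a_kernel_iff sub_cocycles_def sub_functor_def apply_obj_def apply_diff_def
      gr_submodule_def)

text \<open>Cosets and their operations do not refer to the carrier, and intersecting the
  homogeneous parts with \<open>S\<close> has no effect inside \<open>Z\<close>.\<close>

lemma subquotient_gr_submodule:
  "Z \<subseteq> S \<Longrightarrow> subquotient (gr_submodule A S) Z B = subquotient A Z B"
  by (auto simp: subquotient_def gr_submodule_def a_r_coset_def r_coset_def set_add_def set_mult_def fun_eq_iff)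

lemma set_add_gr_submodule: "set_add (gr_submodule A S) = set_add A"
  by (simp add: gr_submodule_def set_add_def set_mult_def fun_eq_iff)

lemma right_derived_sub_functor:
  "right_derived (sub_functor S) res i M =
    subquotient (res_obj (res M) i) (sub_cocycles (res M) S i) (sub_coboundaries (res M) S i)"
proof -
  have "apply_obj (sub_functor S) (res M) i = gr_submodule (res_obj (res M) i) (S (res_obj (res M) i))"
    by (simp add: apply_obj_def sub_functor_def)
  moreover have "sub_cocycles (res M) S i \<subseteq> S (res_obj (res M) i)"
    by (auto simp: sub_cocycles_def)
  ultimately show ?thesis
    unfolding right_derived_def cohomology_eq_subquotient sub_functor_coboundaries sub_functor_cocycles
    by (simp add: subquotient_gr_submodule)
qed

lemma cohomology_map_sub_functor:
  "cohomology_map (apply_obj (sub_functor S) E) (apply_diff (sub_functor S) E) h i X =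
    sub_coboundaries E S i <+>\<^bsub>res_obj E i\<^esub> h i ` X"
  unfolding cohomology_map_def sub_functor_coboundaries
  by (simp add: apply_obj_def sub_functor_def set_add_gr_submodule)

lemma right_derived_map_sub_functor:
  "right_derived_map R (sub_functor S) res i M N f X =
    sub_coboundaries (res N) S i <+>\<^bsub>res_obj (res N) i\<^esub>
      restrict (some_lift R M (res M) (res N) f i) (S (res_obj (res M) i)) ` X"
  unfolding right_derived_map_def cohomology_map_sub_functor by (simp add: sub_functor_def)

lemma local_cohomology_transition_eq:
  "local_cohomology_transition R res i M c d X =
    sub_coboundaries (res M) (gamma_set R d) i <+>\<^bsub>res_obj (res M) i\<^esub> X"
  unfolding local_cohomology_transition_def right_derived_trans_def gamma_eq_sub_functor
    cohomology_map_sub_functor by simp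

lemma injective_resolution_diff_diff:
  assumes "injective_resolution R M E" "x \<in> carrier (res_obj E n)"
  shows "res_diff E (Suc n) (res_diff E n x) = \<zero>\<^bsub>res_obj E (Suc (Suc n))\<^esub>"
proof -
  have "res_diff E n x \<in> res_diff E n ` carrier (res_obj E n)" using assms(2) by (rule imageI)
  then show ?thesis unfolding injective_resolutionD(6)[OF assms(1)] mem_a_kernel_iff by blast
qed

lemma submodule_kernel:
  assumes "module R A" "module R B" "gr_hom R A B f" "submodule H R A"
  shows "submodule {x \<in> H. f x = \<zero>\<^bsub>B\<^esub>} R A"
proof -
  interpret A: module R A by fact
  interpret B: module R B by fact
  interpret f: abelian_group_hom A B f by (rule gr_hom_abelian_group_hom[OF assms(1-3)])
  have carr: "x \<in> carrier A" if "x \<in> H" for x using that A.submoduleE(1)[OF assms(4)] by blast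
  show ?thesis
  proof (rule A.submoduleI)
    show "\<zero>\<^bsub>A\<^esub> \<in> {x \<in> H. f x = \<zero>\<^bsub>B\<^esub>}" using A.submodule_zero[OF assms(4)] by simp
    show "\<ominus>\<^bsub>A\<^esub> a \<in> {x \<in> H. f x = \<zero>\<^bsub>B\<^esub>}" if "a \<in> {x \<in> H. f x = \<zero>\<^bsub>B\<^esub>}" for a
      using that A.submoduleE(3)[OF assms(4)] carr by simp
    show "a \<oplus>\<^bsub>A\<^esub> b \<in> {x \<in> H. f x = \<zero>\<^bsub>B\<^esub>}"
      if "a \<in> {x \<in> H. f x = \<zero>\<^bsub>B\<^esub>}" "b \<in> {x \<in> H. f x = \<zero>\<^bsub>B\<^esub>}" for a b
      using that A.submoduleE(5)[OF assms(4)] carr by simp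
    show "r \<odot>\<^bsub>A\<^esub> x \<in> {x \<in> H. f x = \<zero>\<^bsub>B\<^esub>}"
      if "r \<in> carrier R" "x \<in> {x \<in> H. f x = \<zero>\<^bsub>B\<^esub>}" for r x
      using that A.submoduleE(4)[OF assms(4)] carr gr_hom_smult[OF assms(3)] by simp
  qed (use carr in blast)
qed

lemma submodule_image_submodule:
  fixes A :: "('r, 'a) gr_module" and B :: "('r, 'b) gr_module"
  assumes "module R A" "module R B" "gr_hom R A B f" "submodule H R A"
  shows "submodule (f ` H) R B"
proof -
  interpret A: module R A by fact
  have "gr_hom R (gr_submodule A H) B f"
    using assms(3) A.submoduleE(1)[OF assms(4)]
    by (auto simp: gr_hom_def gr_submodule_def Pi_iff subset_iff image_subset_iff)
  from submodule_image[OF module_gr_submodule[OF assms(1,4)] assms(2) this]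
  show ?thesis by (simp add: gr_submodule_def)
qed

section \<open>Local cohomology as a direct limit\<close>

text \<open>Differentials preserve torsion, so coboundaries are cocycles; shrinking an ideal
  enlarges its torsion, which is monotonicity for the reversed order.\<close>

lemma gamma_subquotient_system:
  fixes E :: "('r, 'm, 'e) coresolution"
  assumes "graded_ring R" "homogeneous_ideal R I" "ideal J R" "injective_resolution R M E"
  shows "subquotient_system R (res_obj E i) (W_tilde R I J) W_le
    (\<lambda>c. sub_cocycles E (gamma_set R c) i) (\<lambda>c. sub_coboundaries E (gamma_set R c) i)"
proof -
  interpret R: graded_ring R by fact
  note E = injective_resolutionD[OF assms(4)]
  have mod: "module R (res_obj E n)" for n
    using graded_module.axioms(2)[OF gr_injective_graded_module[OF E(1)]] .
  have sub: "submodule (gamma_set R c (res_obj E n)) R (res_obj E n)" if "c \<in> W_tilde R I J" for c n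
    using gamma_set_submodule[OF mod W_tilde_ideal[OF that]] .
  show ?thesis
  proof (intro subquotient_system.intro subquotient_system_axioms.intro mod)
    fix c assume c: "c \<in> W_tilde R I J"
    show "submodule (sub_cocycles E (gamma_set R c) i) R (res_obj E i)"
      unfolding sub_cocycles_def by (rule submodule_kernel[OF mod mod E(3) sub[OF c]])
    show "submodule (sub_coboundaries E (gamma_set R c) i) R (res_obj E i)"
      using module.singleton_zero_submodule[OF mod] submodule_image_submodule[OF mod mod E(3) sub[OF c]]
      by (cases i) (simp_all add: sub_coboundaries_def)
    show "sub_coboundaries E (gamma_set R c) i \<subseteq> sub_cocycles E (gamma_set R c) i"
    proof (cases i)
      case 0
      then show ?thesis
        using module.submodule_zero[OF mod submodule_kernel[OF mod mod E(3) sub[OF c]], of 0]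
        by (simp add: sub_coboundaries_def sub_cocycles_def)
    next
      case (Suc k)
      have "res_diff E k ` gamma_set R c (res_obj E k) \<subseteq> gamma_set R c (res_obj E (Suc k))"
        by (rule gr_hom_gamma_set[OF mod mod E(3) W_tilde_ideal[OF c]])
      then show ?thesis
        using injective_resolution_diff_diff[OF assms(4)] gamma_set_subset[of R c "res_obj E k"]
        unfolding Suc sub_coboundaries_def sub_cocycles_def by auto
    qed
    fix d assume d: "d \<in> W_tilde R I J"
    show "\<exists>e\<in>W_tilde R I J. W_le c e \<and> W_le d e"
      using R.W_tilde_Int[OF homogeneous_ideal_ideal[OF assms(2)] assms(3) c d]
      by (rule bexI[rotated]) (simp add: W_le_def)
    assume "W_le c d"
    then have gamma: "gamma_set R c A \<subseteq> gamma_set R d A" for A :: "('r, 'e) gr_module"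
      unfolding W_le_def by (rule R.gamma_set_antimono)
    then show "sub_cocycles E (gamma_set R c) i \<subseteq> sub_cocycles E (gamma_set R d) i"
      unfolding sub_cocycles_def by blast
    show "sub_coboundaries E (gamma_set R c) i \<subseteq> sub_coboundaries E (gamma_set R d) i"
      unfolding sub_coboundaries_def using gamma by (auto split: nat.split)
  next
    show "W_le c e" if "W_le c d" "W_le d e" for c d e :: "'r set"
      using that unfolding W_le_def by blast
    show "W_tilde R I J \<noteq> {}" using R.self_mem_W_tilde[OF assms(2,3)] by blast
  qed
qed

text \<open>Intersecting with a kernel and taking images both commute with unions, so the union
  formula for torsion passes to cocycles and coboundaries.\<close>

lemma Union_gamma_cocycles:
  assumes "graded_ring R" "homogeneous_ideal R I" "ideal J R" "injective_resolution R M E"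
  shows "(\<Union>c\<in>W_tilde R I J. sub_cocycles E (gamma_set R c) i) = sub_cocycles E (gamma_pair_set R I J) i"
    and "(\<Union>c\<in>W_tilde R I J. sub_coboundaries E (gamma_set R c) i) =
      sub_coboundaries E (gamma_pair_set R I J) i"
proof -
  interpret R: graded_ring R by fact
  have gr: "graded_module R (res_obj E n)" for n
    using gr_injective_graded_module[OF injective_resolutionD(1)[OF assms(4)]] .
  note union = gamma_pair_set_eq_Union[OF gr homogeneous_ideal_ideal[OF assms(2)] assms(3)]
  show "(\<Union>c\<in>W_tilde R I J. sub_cocycles E (gamma_set R c) i) = sub_cocycles E (gamma_pair_set R I J) i"
    unfolding sub_cocycles_def union by blast
  show "(\<Union>c\<in>W_tilde R I J. sub_coboundaries E (gamma_set R c) i) =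
      sub_coboundaries E (gamma_pair_set R I J) i"
    \<comment> \<open>In degree 0 every term of the union is the zero submodule, and the union is
      again zero because there is at least one index.\<close>
    using R.self_mem_W_tilde[OF assms(2,3)]
    by (cases i) (auto simp: sub_coboundaries_def union)
qed

lemma lim_local_cohomology_eq:
  "lim_local_cohomology R I J res i M =
    direct_limit (W_tilde R I J) W_le
      (\<lambda>c. subquotient (res_obj (res M) i) (sub_cocycles (res M) (gamma_set R c) i)
        (sub_coboundaries (res M) (gamma_set R c) i))
      (\<lambda>c d X. sub_coboundaries (res M) (gamma_set R d) i <+>\<^bsub>res_obj (res M) i\<^esub> X)"
proof -
  have "local_cohomology_transition R res i M =
      (\<lambda>c d X. sub_coboundaries (res M) (gamma_set R d) i <+>\<^bsub>res_obj (res M) i\<^esub> X)"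
    by (intro ext) (rule local_cohomology_transition_eq)
  then show ?thesis
    unfolding lim_local_cohomology_def gamma_eq_sub_functor right_derived_sub_functor by simp
qed

lemma lim_local_cohomology_map_eq:
  "lim_local_cohomology_map R I J res i M N f =
    direct_limit_map (W_tilde R I J) W_le
      (\<lambda>c. subquotient (res_obj (res N) i) (sub_cocycles (res N) (gamma_set R c) i)
        (sub_coboundaries (res N) (gamma_set R c) i))
      (\<lambda>c d X. sub_coboundaries (res N) (gamma_set R d) i <+>\<^bsub>res_obj (res N) i\<^esub> X)
      (\<lambda>c X. sub_coboundaries (res N) (gamma_set R c) i <+>\<^bsub>res_obj (res N) i\<^esub>
        restrict (some_lift R M (res M) (res N) f i) (gamma_set R c (res_obj (res M) i)) ` X)"
proof -
  have "local_cohomology_transition R res i N =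
      (\<lambda>c d X. sub_coboundaries (res N) (gamma_set R d) i <+>\<^bsub>res_obj (res N) i\<^esub> X)"
    by (intro ext) (rule local_cohomology_transition_eq)
  moreover have "right_derived_map R (gamma R c) res i M N f =
      (\<lambda>X. sub_coboundaries (res N) (gamma_set R c) i <+>\<^bsub>res_obj (res N) i\<^esub>
        restrict (some_lift R M (res M) (res N) f i) (gamma_set R c (res_obj (res M) i)) ` X)" for c
    unfolding gamma_eq_sub_functor by (intro ext) (rule right_derived_map_sub_functor)
  ultimately show ?thesis
    unfolding lim_local_cohomology_map_def gamma_eq_sub_functor right_derived_sub_functor by simp
qed

theorem proposition2p2:
  fixes R :: "'r gr_ring" and I J :: "'r set"
    and res :: "('r, 'm) gr_module \<Rightarrow> ('r, 'm, 'e) coresolution" and i :: nat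
  assumes "graded_ring R"
    and "homogeneous_ideal R I"
    and "ideal J R"
    and "injective_resolution_choice R res"
  shows "\<exists>\<phi>.
    (\<forall>M. graded_module R M \<longrightarrow>
       gr_iso R (right_derived (gamma_pair R I J) res i M)
                (lim_local_cohomology R I J res i M) (\<phi> M)) \<and>
    (\<forall>M N f. graded_module R M \<longrightarrow> graded_module R N \<longrightarrow> gr_hom R M N f \<longrightarrow>
       (\<forall>x\<in>carrier (right_derived (gamma_pair R I J) res i M).
          \<phi> N (right_derived_map R (gamma_pair R I J) res i M N f x) =
          lim_local_cohomology_map R I J res i M N f (\<phi> M x)))"
proof -
  let ?W = "W_tilde R I J"
  let ?A = "\<lambda>M. res_obj (res M) i"
  let ?Z = "\<lambda>M c. sub_cocycles (res M) (gamma_set R c) i"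
  let ?B = "\<lambda>M c. sub_coboundaries (res M) (gamma_set R c) i"
  \<comment> \<open>One formula for all modules, depending on \<open>M\<close> only through its
    chosen resolution.\<close>
  define \<phi> where "\<phi> M = colimit_class ?W (?A M) (?Z M) (?B M)" for M
  have res: "injective_resolution R M (res M)" if "graded_module R M" for M
    using assms(4) that unfolding injective_resolution_choice_def by blast
  note sys = gamma_subquotient_system[OF assms(1-3) res]
  have derived: "right_derived (gamma_pair R I J) res i M =
      subquotient (?A M) (\<Union>c\<in>?W. ?Z M c) (\<Union>c\<in>?W. ?B M c)" if "graded_module R M" for M
    unfolding gamma_pair_eq_sub_functor right_derived_sub_functor
      Union_gamma_cocycles[OF assms(1-3) res[OF that]] ..
  show ?thesis
  proof (intro exI[of _ \<phi>] conjI allI impI ballI)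
    fix M :: "('r, 'm) gr_module" assume M: "graded_module R M"
    show "gr_iso R (right_derived (gamma_pair R I J) res i M) (lim_local_cohomology R I J res i M) (\<phi> M)"
      unfolding derived[OF M] lim_local_cohomology_eq \<phi>_def
      by (rule subquotient_system.gr_iso_colimit_class[OF sys[OF M]])
  next
    fix M N :: "('r, 'm) gr_module" and f x
    assume M: "graded_module R M" and N: "graded_module R N" and f: "gr_hom R M N f"
      and x: "x \<in> carrier (right_derived (gamma_pair R I J) res i M)"
    \<comment> \<open>Nothing is known of this choice except that it is a lift. The same lift occurs
      on both sides of the naturality square, so no homotopy has to be considered.\<close>
    let ?g = "some_lift R M (res M) (res N) f"
    have lift: "is_lift R M (res M) (res N) f ?g"
      unfolding some_lift_def
      by (rule someI_ex[OF injective_resolution_lift_exists[OF res[OF M] res[OF N] M N f]])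
    have g: "gr_hom R (res_obj (res M) n) (res_obj (res N) n) (?g n)" for n
      using lift unfolding is_lift_def by (elim conjE) (erule spec)
    have g_diff: "?g (Suc n) (res_diff (res M) n y) = res_diff (res N) n (?g n y)"
      if "y \<in> carrier (res_obj (res M) n)" for n y
      using lift that unfolding is_lift_def by simp
    have mod: "module R (res_obj (res M) n)" "module R (res_obj (res N) n)" for n
      using graded_module.axioms(2)[OF gr_injective_graded_module[OF injective_resolutionD(1)[OF res]]] M N
      by blast+
    have gamma: "?g n ` gamma_set R c (res_obj (res M) n) \<subseteq> gamma_set R c (res_obj (res N) n)"
      if "c \<in> ?W" for c n
      by (rule gr_hom_gamma_set[OF mod g W_tilde_ideal[OF that]])
    have zero: "?g n \<zero>\<^bsub>res_obj (res M) n\<^esub> = \<zero>\<^bsub>res_obj (res N) n\<^esub>" for n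
      using abelian_group_hom.hom_zero[OF gr_hom_abelian_group_hom[OF mod g]] .
    have gZ: "?g i ` ?Z M c \<subseteq> ?Z N c" if c: "c \<in> ?W" for c
    proof (rule image_subsetI)
      fix z assume z: "z \<in> ?Z M c"
      then have zg: "z \<in> gamma_set R c (?A M)" by (simp add: sub_cocycles_def)
      have zc: "z \<in> carrier (?A M)" using subsetD[OF gamma_set_subset zg] .
      have "res_diff (res N) i (?g i z) = \<zero>\<^bsub>res_obj (res N) (Suc i)\<^esub>"
        using g_diff[OF zc] z zero unfolding sub_cocycles_def by simp
      then show "?g i z \<in> ?Z N c" using zg gamma[OF c, of i] by (auto simp: sub_cocycles_def)
    qed
    have gB: "?g i ` ?B M c \<subseteq> ?B N c" if c: "c \<in> ?W" for c
    proof (cases i)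
      case 0
      then show ?thesis using zero by (simp add: sub_coboundaries_def)
    next
      case (Suc k)
      have "?g (Suc k) (res_diff (res M) k y) \<in> res_diff (res N) k ` gamma_set R c (res_obj (res N) k)"
        if y: "y \<in> gamma_set R c (res_obj (res M) k)" for y
        using g_diff[OF subsetD[OF gamma_set_subset y]] gamma[OF c, of k] y by auto
      then show ?thesis unfolding Suc by (auto simp: sub_coboundaries_def)
    qed
    show "\<phi> N (right_derived_map R (gamma_pair R I J) res i M N f x) =
        lim_local_cohomology_map R I J res i M N f (\<phi> M x)"
      unfolding \<phi>_def lim_local_cohomology_map_eq gamma_pair_eq_sub_functor right_derived_map_sub_functor
        Union_gamma_cocycles(2)[OF assms(1-3) res[OF N], symmetric]
    proof (rule subquotient_system.direct_limit_map_colimit_class[OF sys[OF M] sys[OF N], where g = "?g i"])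
      show "x \<in> carrier (subquotient (?A M) (\<Union>c\<in>?W. ?Z M c) (\<Union>c\<in>?W. ?B M c))"
        using x unfolding derived[OF M] .
      show "restrict (?g i) (gamma_set R c (?A M)) z = ?g i z" if "z \<in> ?Z M c" for c z
        using that by (simp add: sub_cocycles_def)
      show "restrict (?g i) (gamma_pair_set R I J (?A M)) z = ?g i z" if "z \<in> (\<Union>c\<in>?W. ?Z M c)" for z
        using that unfolding Union_gamma_cocycles(1)[OF assms(1-3) res[OF M]] by (simp add: sub_cocycles_def)
    qed (use gr_hom_closed[OF g] gr_hom_add[OF g] gZ gB in blast)+
  qed
qed

end
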